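(* Consider the one-dimensional chain of $N$ harmonic oscillators in which all pinning parameters coincide ($\eta_i=\eta>0$), all interaction parameters coincide ($\xi_{i}=\xi>0$) and all masses coincide ($m_i=m>0$), and assume that there is at least one particle with non-zero friction and diffusion at one of the terminal ends of the chain, i.e. $\emptyset\neq I\subset\{1,N\}$. Then the spectral gap $\lambda_S$ of the chain satisfies $$N^{-3}\lesssim\lambda_S\lesssim N^{-3}.$$
   Context: Setting: sites $[N]=\{1,\dots,N\}$; $I\subset[N]$ is the set of particles subject to friction and diffusion, with friction parameters $\gamma_i>0$, $i\in I$. Let $B_N$ be the self-adjoint matrix on $\mathbb C^N$ with quadratic form $\langle u,B_Nu\rangle=\sum_{n=1}^{N-1}\xi|u(n)-u(n+1)|^2+\sum_{n=1}^N\eta|u(n)|^2$ (discrete Schrödinger operator with Neumann boundary conditions), $\mathbf m=m\operatorname{id}$, $\Gamma=\operatorname{diag}(\gamma_n\delta_{n\in I})$, and $$M_N=\begin{pmatrix}\Gamma&-\mathbf m^{-1}\\ B_N&0\end{pmatrix}\in\mathbb C^{2N\times 2N}.$$ The dynamics is the Ornstein–Uhlenbeck process with generator $\mathcal Lf(z)=-zM_N\cdot\nabla_zf(z)+\nabla_p\cdot\Gamma\mathbf m\Theta\nabla_pf(z)$, $z=(p,q)$, with $\Theta=\operatorname{diag}(\beta_n^{-1}\delta_{n\in I})$ the (positive) bath temperatures. The spectral gap is $\lambda_S:=\inf\{\operatorname{Re}(\lambda):\lambda\in\operatorname{Spec}(M_N)\}$. The parameters $\eta,\xi,m$ and the friction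 parameters are independent of $N$. $f(N)\lesssim g(N)$ means $f(N)\le Cg(N)$ with $C>0$ independent of $N$. *)

theory Defs
  imports "Jordan_Normal_Form.Spectral_Radius" "Jordan_Normal_Form.Schur_Decomposition"
begin

(* Vector and matrix indices start at 0, so the n-th site of the chain, 1 <= n <= N, is stored at
   index n - 1. *)

definition is_chain_potential :: "nat \<Rightarrow> real \<Rightarrow> real \<Rightarrow> complex mat \<Rightarrow> bool" where
  "is_chain_potential N \<xi> \<eta> B \<longleftrightarrow>
     B \<in> carrier_mat N N \<and> mat_adjoint B = B \<and>
     (\<forall>u \<in> carrier_vec N. (B *\<^sub>v u) \<bullet>c u =
        complex_of_real ((\<Sum>n = 1..<N. \<xi> * (cmod (u $ (n - 1) - u $ n))\<^sup>2)
                         + (\<Sum>n = 1..N. \<eta> * (cmod (u $ (n - 1)))\<^sup>2)))"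

(* Well defined by chain_potential_ex1 below; chain_potential_eq gives the entries. *)
definition chain_potential :: "nat \<Rightarrow> real \<Rightarrow> real \<Rightarrow> complex mat" where
  "chain_potential N \<xi> \<eta> = (THE B. is_chain_potential N \<xi> \<eta> B)"

definition friction_mat :: "nat \<Rightarrow> nat set \<Rightarrow> (nat \<Rightarrow> real) \<Rightarrow> complex mat" where
  "friction_mat N I \<gamma> =
     mat_diag N (\<lambda>k. if Suc k \<in> I then complex_of_real (\<gamma> (Suc k)) else 0)"

definition chain_mat ::
    "nat \<Rightarrow> real \<Rightarrow> real \<Rightarrow> real \<Rightarrow> nat set \<Rightarrow> (nat \<Rightarrow> real) \<Rightarrow> complex mat" where
  "chain_mat N \<xi> \<eta> m I \<gamma> =
     four_block_mat (friction_mat N I \<gamma>)           (- (complex_of_real (inverse m) \<cdot>\<^sub>m 1\<^sub>m N))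
                    (chain_potential N \<xi> \<eta>)         (0\<^sub>m N N)"

(* The spectrum is finite, and nonempty for N >= 1, so this infimum is a minimum. *)
definition spectral_gap :: "complex mat \<Rightarrow> real" where
  "spectral_gap M = Inf (Re ` spectrum M)"

definition tridiag_potential :: "nat \<Rightarrow> real \<Rightarrow> real \<Rightarrow> complex mat" where
  "tridiag_potential N \<xi> \<eta> = mat N N (\<lambda>(i, j). complex_of_real (
     if i = j then \<eta> + (if 0 < i then \<xi> else 0) + (if Suc i < N then \<xi> else 0)
     else if i = Suc j \<or> j = Suc i then - \<xi> else 0))"

lemma mat_adjoint_alt:
  "A \<in> carrier_mat n n \<Longrightarrow> mat_adjoint A = mat n n (\<lambda>(i, j). cnj (A $$ (j, i)))"
  by (rule eq_matI) (auto simp: mat_adjoint_def mat_of_rows_def)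

lemma tridiag_mult_vec:
  assumes u: "u \<in> carrier_vec N" and i: "i < N"
  shows "(tridiag_potential N \<xi> \<eta> *\<^sub>v u) $ i =
     \<eta> * u $ i + (if 0 < i then \<xi> * (u $ i - u $ (i - 1)) else 0)
     + (if Suc i < N then \<xi> * (u $ i - u $ Suc i) else 0)"
proof -
  let ?d = "complex_of_real (\<eta> + (if 0 < i then \<xi> else 0) + (if Suc i < N then \<xi> else 0))"
  have "(tridiag_potential N \<xi> \<eta> *\<^sub>v u) $ i =
     (\<Sum>j = 0..<N. tridiag_potential N \<xi> \<eta> $$ (i, j) * u $ j)"
    using u i by (simp add: tridiag_potential_def scalar_prod_def)
  also have "\<dots> = (\<Sum>j = 0..<N. (if j = i then ?d * u $ i else 0)
      + (if j = i - 1 then (if 0 < i then - \<xi> * u $ (i - 1) else 0) else 0)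
      + (if j = Suc i then - \<xi> * u $ Suc i else 0))"
    using i by (intro sum.cong) (auto simp: tridiag_potential_def)
  also have "\<dots> = ?d * u $ i + (if 0 < i then - \<xi> * u $ (i - 1) else 0)
      + (if Suc i < N then - \<xi> * u $ Suc i else 0)"
    using i by (simp add: sum.distrib sum.delta')
  finally show ?thesis by (auto simp: algebra_simps)
qed

lemma is_chain_potential_tridiag: "is_chain_potential N \<xi> \<eta> (tridiag_potential N \<xi> \<eta>)"
  unfolding is_chain_potential_def
proof (intro conjI ballI)
  let ?B = "tridiag_potential N \<xi> \<eta>"
  show B: "?B \<in> carrier_mat N N" by (simp add: tridiag_potential_def)
  show "mat_adjoint ?B = ?B"
    by (subst mat_adjoint_alt[OF B]) (rule eq_matI; auto simp: tridiag_potential_def)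
  fix u :: "complex vec" assume u: "u \<in> carrier_vec N"
  have sq: "complex_of_real ((cmod z)\<^sup>2) = z * cnj z" for z by (rule complex_norm_square)
  have "(?B *\<^sub>v u) \<bullet>c u = (\<Sum>i = 0..<N. (?B *\<^sub>v u) $ i * cnj (u $ i))"
    using u by (simp add: scalar_prod_def)
  also have "\<dots> = (\<Sum>i = 0..<N. \<eta> * (u $ i * cnj (u $ i))
      + (if 0 < i then \<xi> * (u $ i - u $ (i - 1)) * cnj (u $ i) else 0)
      + (if Suc i < N then \<xi> * (u $ i - u $ Suc i) * cnj (u $ i) else 0))"
    by (intro sum.cong refl) (simp add: tridiag_mult_vec[OF u] algebra_simps)
  also have "\<dots> = (\<Sum>i = 0..<N. \<eta> * (u $ i * cnj (u $ i)))
      + (\<Sum>i = 0..<N. if 0 < i then \<xi> * (u $ i - u $ (i - 1)) * cnj (u $ i) else 0)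
      + (\<Sum>i = 0..<N. if Suc i < N then \<xi> * (u $ i - u $ Suc i) * cnj (u $ i) else 0)"
    by (simp add: sum.distrib)
  also have "(\<Sum>i = 0..<N. \<eta> * (u $ i * cnj (u $ i)))
      = (\<Sum>n = 1..N. \<eta> * (u $ (n - 1) * cnj (u $ (n - 1))))"
    by (rule sum.reindex_bij_witness[of _ "\<lambda>n. n - 1" Suc]) auto
  also have "(\<Sum>i = 0..<N. if 0 < i then \<xi> * (u $ i - u $ (i - 1)) * cnj (u $ i) else 0)
      = (\<Sum>n = 1..<N. \<xi> * (u $ n - u $ (n - 1)) * cnj (u $ n))"
    by (rule sum.mono_neutral_cong_right) auto
  also have "(\<Sum>i = 0..<N. if Suc i < N then \<xi> * (u $ i - u $ Suc i) * cnj (u $ i) else 0)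
      = (\<Sum>i = 0..<N - 1. \<xi> * (u $ i - u $ Suc i) * cnj (u $ i))"
    by (rule sum.mono_neutral_cong_right) auto
  also have "\<dots> = (\<Sum>n = 1..<N. \<xi> * (u $ (n - 1) - u $ n) * cnj (u $ (n - 1)))"
    by (rule sum.reindex_bij_witness[of _ "\<lambda>n. n - 1" Suc]) auto
  finally have 1: "(?B *\<^sub>v u) \<bullet>c u =
      (\<Sum>n = 1..N. \<eta> * (u $ (n - 1) * cnj (u $ (n - 1))))
      + ((\<Sum>n = 1..<N. \<xi> * (u $ n - u $ (n - 1)) * cnj (u $ n))
      + (\<Sum>n = 1..<N. \<xi> * (u $ (n - 1) - u $ n) * cnj (u $ (n - 1))))"
    by (simp only: add.assoc)
  have 2: "(\<Sum>n = 1..<N. \<xi> * (u $ n - u $ (n - 1)) * cnj (u $ n))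
      + (\<Sum>n = 1..<N. \<xi> * (u $ (n - 1) - u $ n) * cnj (u $ (n - 1)))
      = (\<Sum>n = 1..<N. \<xi> * ((u $ (n - 1) - u $ n) * cnj (u $ (n - 1) - u $ n)))"
    unfolding sum.distrib[symmetric] by (intro sum.cong refl) (simp add: algebra_simps)
  show "(?B *\<^sub>v u) \<bullet>c u =
        complex_of_real ((\<Sum>n = 1..<N. \<xi> * (cmod (u $ (n - 1) - u $ n))\<^sup>2)
                         + (\<Sum>n = 1..N. \<eta> * (cmod (u $ (n - 1)))\<^sup>2))"
    unfolding 1 2 of_real_add of_real_sum of_real_mult sq by (rule add.commute)
qed

lemma quadratic_form_unit_vecs:
  assumes B: "(B :: complex mat) \<in> carrier_mat n n" and i: "i < n" and j: "j < n"
  shows "(B *\<^sub>v (unit_vec n i + z \<cdot>\<^sub>v unit_vec n j)) \<bullet>c (unit_vec n i + z \<cdot>\<^sub>v unit_vec n j)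
    = B $$ (i, i) + z * B $$ (i, j) + cnj z * B $$ (j, i) + z * cnj z * B $$ (j, j)"
proof -
  let ?u = "unit_vec n i + z \<cdot>\<^sub>v unit_vec n j"
  have U: "?u $ k = (if k = i then 1 else 0) + z * (if k = j then 1 else 0)" if "k < n" for k
    using that i j by (simp add: unit_vec_def)
  have Bu: "(B *\<^sub>v ?u) $ k = B $$ (k, i) + z * B $$ (k, j)" if k: "k < n" for k
  proof -
    have "(B *\<^sub>v ?u) $ k = (\<Sum>l = 0..<n. B $$ (k, l) * ?u $ l)"
      using B k by (simp add: scalar_prod_def)
    also have "\<dots> = (\<Sum>l = 0..<n. (if l = i then B $$ (k, i) else 0)
        + (if l = j then z * B $$ (k, j) else 0))"
      using i j by (intro sum.cong refl) (auto simp: unit_vec_def algebra_simps)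
    finally show ?thesis using i j by (simp add: sum.distrib sum.delta')
  qed
  have "(B *\<^sub>v ?u) \<bullet>c ?u = (\<Sum>k = 0..<n. (B *\<^sub>v ?u) $ k * cnj (?u $ k))"
    by (simp add: scalar_prod_def)
  also have "\<dots> = (\<Sum>k = 0..<n. (if k = i then B $$ (i, i) + z * B $$ (i, j) else 0)
      + (if k = j then cnj z * (B $$ (j, i) + z * B $$ (j, j)) else 0))"
    using i j by (intro sum.cong refl) (simp add: Bu U algebra_simps del: index_mult_mat_vec)
  also have "\<dots> = B $$ (i, i) + z * B $$ (i, j) + cnj z * (B $$ (j, i) + z * B $$ (j, j))"
    using i j by (simp add: sum.distrib sum.delta')
  finally show ?thesis by (simp add: algebra_simps)
qed

lemma quadratic_form_inj:
  assumes B: "(B :: complex mat) \<in> carrier_mat n n" and C: "C \<in> carrier_mat n n"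
    and eq: "\<And>u. u \<in> carrier_vec n \<Longrightarrow> (B *\<^sub>v u) \<bullet>c u = (C *\<^sub>v u) \<bullet>c u"
  shows "B = C"
proof (rule eq_matI)
  fix i j assume "i < dim_row C" "j < dim_col C"
  then have i: "i < n" and j: "j < n" using C by auto
  have E: "B $$ (i, i) + z * B $$ (i, j) + cnj z * B $$ (j, i) + z * cnj z * B $$ (j, j)
      = C $$ (i, i) + z * C $$ (i, j) + cnj z * C $$ (j, i) + z * cnj z * C $$ (j, j)" for z
    using eq[of "unit_vec n i + z \<cdot>\<^sub>v unit_vec n j"]
    unfolding quadratic_form_unit_vecs[OF B i j] quadratic_form_unit_vecs[OF C i j] by simp
  define D where "D k l = B $$ (k, l) - C $$ (k, l)" for k l
  have F: "D i i + z * D i j + cnj z * D j i + z * cnj z * D j j = 0" for z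
    using E[of z] by (simp add: D_def algebra_simps)
  have a: "D i i = 0" using F[of 0] by simp
  have b: "D i j + D j i + D j j = 0" using F[of 1] a by simp
  have c: "- D i j - D j i + D j j = 0" using F[of "-1"] a by simp
  have d: "\<i> * (D i j - D j i) + D j j = 0" using F[of \<i>] a by (simp add: algebra_simps)
  have "2 * D j j = (D i j + D j i + D j j) + (- D i j - D j i + D j j)" by simp
  then have jj: "D j j = 0" using b c by simp
  have "D i j = D j i" using d jj by simp
  then have "D i j = 0" using b jj by simp
  then show "B $$ (i, j) = C $$ (i, j)" by (simp add: D_def)
qed (use B C in auto)

lemma is_chain_potential_unique:
  "is_chain_potential N \<xi> \<eta> B \<Longrightarrow> is_chain_potential N \<xi> \<eta> C \<Longrightarrow> B = C"
  unfolding is_chain_potential_def by (intro quadratic_form_inj) auto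

lemma chain_potential_ex1: "\<exists>!B. is_chain_potential N \<xi> \<eta> B"
  using is_chain_potential_tridiag is_chain_potential_unique by blast

lemma chain_potential_eq: "chain_potential N \<xi> \<eta> = tridiag_potential N \<xi> \<eta>"
  unfolding chain_potential_def
  using is_chain_potential_tridiag is_chain_potential_unique by blast

end

theory Submission
  imports Defs
begin

text \<open>An eigenvalue \<open>z\<close> with momentum vector \<open>p\<close> satisfies \<open>(m z\<^sup>2 - m z \<Gamma> + B) p = 0\<close>. Pairing with \<open>p\<close>
  shows that \<open>z\<close> is either real and bounded away from \<open>0\<close>, or has real part
  \<open>\<langle>p, \<Gamma> p\<rangle> / (2 \<parallel>p\<parallel>\<^sup>2)\<close>. In the latter case, if \<open>Re z\<close> is at most of order \<open>N\<^sup>-\<^sup>2\<close>, then \<open>p\<close> solves a three term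
  recurrence that is an \<open>O(N\<^sup>-\<^sup>2)\<close> perturbation of one with at most linear growth, so
  \<open>|p n|\<close> is at most of order \<open>N\<close> times the amplitude at a damped end. Summing squares gives the
  lower bound.

  For the upper bound, follow the argument of the characteristic polynomial up the imaginary axis. It
  is the sum of the angles under which the roots are seen, and beyond the largest zero \<open>s\<^sub>0\<close> of the
  polynomial's imaginary part it changes by less than \<open>\<pi>\<close>. If all roots have real part at least
  \<open>a\<close>, the rate of change is, up to a factor \<open>3\<close>, constant on an interval of length \<open>a\<close>; hence
  \<open>a\<close> times the rate at \<open>s\<^sub>0\<close> is at most \<open>3 \<pi>\<close>. That rate is explicit in Chebyshev polynomials,
  and is of order \<open>N\<^sup>3\<close> because \<open>s\<^sub>0\<close> lies at the top edge of the band.\<close>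

section \<open>The quadratic eigenvalue problem\<close>

lemma chain_mat_eigenvector_iff:
  fixes I :: "nat set" and \<gamma> :: "nat \<Rightarrow> real"
  assumes m: "m \<noteq> 0" and p: "p \<in> carrier_vec N" and q: "q \<in> carrier_vec N"
  defines "g \<equiv> \<lambda>i. complex_of_real (if Suc i \<in> I then \<gamma> (Suc i) else 0)"
  shows "chain_mat N \<xi> \<eta> m I \<gamma> *\<^sub>v (p @\<^sub>v q) = z \<cdot>\<^sub>v (p @\<^sub>v q) \<longleftrightarrow>
    (\<forall>i<N. q $ i = m * (g i - z) * p $ i \<and> (tridiag_potential N \<xi> \<eta> *\<^sub>v p) $ i = z * q $ i)"
proof -
  let ?M = "chain_mat N \<xi> \<eta> m I \<gamma>" and ?B = "tridiag_potential N \<xi> \<eta>" and ?v = "p @\<^sub>v q"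
  have B: "?B \<in> carrier_mat N N" by (simp add: tridiag_potential_def)
  have dims: "dim_vec p = N" "dim_vec q = N" using p q by auto
  have Mdim: "dim_row ?M = N + N"
    by (simp add: chain_mat_def friction_mat_def mat_diag_def)
  have top: "(?M *\<^sub>v ?v) $ i = g i * p $ i - q $ i / m" if i: "i < N" for i
  proof -
    have "row ?M i = row (friction_mat N I \<gamma>) i @\<^sub>v row (- (complex_of_real (inverse m) \<cdot>\<^sub>m 1\<^sub>m N)) i"
      unfolding chain_mat_def chain_potential_eq
      by (rule row_four_block_mat) (use i B in \<open>auto simp: friction_mat_def mat_diag_def\<close>)
    then have "(?M *\<^sub>v ?v) $ i = row (friction_mat N I \<gamma>) i \<bullet> p
        + row (- (complex_of_real (inverse m) \<cdot>\<^sub>m 1\<^sub>m N)) i \<bullet> q"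
      using i p q Mdim
      by (simp, subst scalar_prod_append[of _ N _ N]) (auto simp: friction_mat_def)
    also have "row (friction_mat N I \<gamma>) i \<bullet> p = (\<Sum>j = 0..<N. if j = i then g i * p $ i else 0)"
      using i dims unfolding scalar_prod_def
      by (intro sum.cong) (auto simp: friction_mat_def mat_diag_def g_def)
    also have "row (- (complex_of_real (inverse m) \<cdot>\<^sub>m 1\<^sub>m N)) i \<bullet> q
        = (\<Sum>j = 0..<N. if j = i then - (q $ i / m) else 0)"
      using i dims unfolding scalar_prod_def
      by (intro sum.cong) (auto simp: field_simps of_real_inverse)
    finally show ?thesis using i by simp
  qed
  have bot: "(?M *\<^sub>v ?v) $ (N + i) = (?B *\<^sub>v p) $ i" if i: "i < N" for i
  proof -
    have "row ?M (N + i) = row ?B (N + i - N) @\<^sub>v row (0\<^sub>m N N) (N + i - N)"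
      unfolding chain_mat_def chain_potential_eq
      by (rule row_four_block_mat(2)[of "friction_mat N I \<gamma>" N N _ N _ N])
        (use i B in \<open>auto simp: friction_mat_def mat_diag_def\<close>)
    then have "(?M *\<^sub>v ?v) $ (N + i) = row ?B i \<bullet> p + row (0\<^sub>m N N) i \<bullet> q"
      using i p q B Mdim by (simp, subst scalar_prod_append[of _ N _ N]) auto
    then show ?thesis using i q B by simp
  qed
  have "?M *\<^sub>v ?v = z \<cdot>\<^sub>v ?v \<longleftrightarrow> (\<forall>k < N + N. (?M *\<^sub>v ?v) $ k = (z \<cdot>\<^sub>v ?v) $ k)"
    by (subst vec_eq_iff) (use Mdim dims in simp)
  also have "\<dots> \<longleftrightarrow> (\<forall>i<N. (?M *\<^sub>v ?v) $ i = z * p $ i \<and> (?M *\<^sub>v ?v) $ (N + i) = z * q $ i)"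
  proof (intro iffI allI impI)
    fix k assume *: "\<forall>i<N. (?M *\<^sub>v ?v) $ i = z * p $ i \<and> (?M *\<^sub>v ?v) $ (N + i) = z * q $ i"
      and k: "k < N + N"
    show "(?M *\<^sub>v ?v) $ k = (z \<cdot>\<^sub>v ?v) $ k"
    proof (cases "k < N")
      case True then show ?thesis using * k dims by simp
    next
      case False
      then obtain i where "k = N + i" using le_Suc_ex not_less by blast
      then show ?thesis using * k dims by simp
    qed
  qed (use dims in auto)
  also have "\<dots> \<longleftrightarrow> (\<forall>i<N. q $ i = m * (g i - z) * p $ i \<and> (?B *\<^sub>v p) $ i = z * q $ i)"
    using m bot[unfolded add.commute[of N]] by (auto simp: top field_simps simp del: index_mult_mat_vec)
  finally show ?thesis .
qed

text \<open>\<open>p\<close> is the momentum half of an eigenvector; the position half \<open>m (\<Gamma> - z) p\<close> is eliminated.\<close>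

definition chain_mode ::
    "nat \<Rightarrow> real \<Rightarrow> real \<Rightarrow> real \<Rightarrow> (nat \<Rightarrow> real) \<Rightarrow> complex \<Rightarrow> complex vec \<Rightarrow> bool" where
  "chain_mode N \<xi> \<eta> m g z p \<longleftrightarrow> p \<in> carrier_vec N \<and> p \<noteq> 0\<^sub>v N \<and>
     (\<forall>i<N. (tridiag_potential N \<xi> \<eta> *\<^sub>v p) $ i = z * m * (g i - z) * p $ i)"

text \<open>Eliminating \<open>q\<close> loses no eigenvector: \<open>p = 0\<close> would force
  \<open>q = 0\<close>, and any mode \<open>p\<close> extends by
  \<open>q = m (\<Gamma> - z) p\<close>, read off from the friction row.\<close>

lemma spectrum_chain_mat_iff:
  fixes I :: "nat set" and \<gamma> :: "nat \<Rightarrow> real"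
  assumes m: "m \<noteq> 0"
  defines "g \<equiv> \<lambda>i. (if Suc i \<in> I then \<gamma> (Suc i) else 0)"
  shows "z \<in> spectrum (chain_mat N \<xi> \<eta> m I \<gamma>) \<longleftrightarrow>
    (\<exists>p. chain_mode N \<xi> \<eta> m g z p)"
    (is "?L \<longleftrightarrow> ?R")
proof
  have dim: "dim_row (chain_mat N \<xi> \<eta> m I \<gamma>) = N + N"
    by (simp add: chain_mat_def friction_mat_def mat_diag_def)
  note iff = chain_mat_eigenvector_iff[OF m, of _ N _ \<xi> \<eta> I \<gamma> z]
  {
    assume ?L
    then obtain v where v: "v \<in> carrier_vec (N + N)" "v \<noteq> 0\<^sub>v (N + N)"
      and ev: "chain_mat N \<xi> \<eta> m I \<gamma> *\<^sub>v v = z \<cdot>\<^sub>v v"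
      unfolding spectrum_def eigenvalue_def eigenvector_def dim by auto
    define p q where "p = vec_first v N" and "q = vec_last v N"
    have pq: "p \<in> carrier_vec N" "q \<in> carrier_vec N" "v = p @\<^sub>v q"
      using v by (simp_all add: p_def q_def)
    have eqs: "\<forall>i<N. q $ i = m * (g i - z) * p $ i
        \<and> (tridiag_potential N \<xi> \<eta> *\<^sub>v p) $ i = z * q $ i"
      using ev iff[OF pq(1,2)] unfolding pq(3) by (simp add: g_def)
    have "p \<noteq> 0\<^sub>v N"
    proof
      assume p0: "p = 0\<^sub>v N"
      then have "q = 0\<^sub>v N" using eqs pq(2) by (intro eq_vecI) auto
      then have "v = 0\<^sub>v (N + N)" using p0 pq(3) by (intro eq_vecI) auto
      then show False using v by simp
    qed
    then show ?R using pq(1) eqs by (intro exI[of _ p]) (auto simp: chain_mode_def mult.assoc)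
  }
  {
    assume ?R
    then obtain p where p: "p \<in> carrier_vec N" "p \<noteq> 0\<^sub>v N"
      and eqs: "\<forall>i<N. (tridiag_potential N \<xi> \<eta> *\<^sub>v p) $ i = z * m * (g i - z) * p $ i"
      unfolding chain_mode_def by blast
    define q where "q = vec N (\<lambda>i. m * (g i - z) * p $ i)"
    have q: "q \<in> carrier_vec N" by (simp add: q_def)
    have "chain_mat N \<xi> \<eta> m I \<gamma> *\<^sub>v (p @\<^sub>v q) = z \<cdot>\<^sub>v (p @\<^sub>v q)"
      using iff[OF p(1) q] eqs by (auto simp: q_def g_def mult.assoc)
    moreover have "p @\<^sub>v q \<noteq> 0\<^sub>v (N + N)"
    proof
      assume *: "p @\<^sub>v q = 0\<^sub>v (N + N)"
      have "p $ i = 0" if "i < N" for i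
        using arg_cong[OF *, of "\<lambda>v. v $ i"] that p(1) q by simp
      then have "p = 0\<^sub>v N" using p(1) by (intro eq_vecI) auto
      then show False using p(2) by simp
    qed
    ultimately show ?L
      unfolding spectrum_def eigenvalue_def eigenvector_def dim using p(1) q
      by (auto intro!: exI[of _ "p @\<^sub>v q"])
  }
qed

section \<open>Lower bound\<close>

text \<open>Splitting the recurrence as below makes the growth linear, up to perturbation terms of
  total size at most \<open>cmod d * N^2 * M\<close>, with \<open>M\<close> the maximum of the
  solution; the hypothesis on \<open>d\<close> makes these at most \<open>M / 2\<close>, which the
  left side absorbs.\<close>

lemma perturbed_recurrence_growth:
  fixes f :: "nat \<Rightarrow> complex" and x A :: real and d :: complex
  assumes x: "\<bar>x\<bar> \<le> 2" and A: "0 \<le> A"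
    and rec: "\<And>n. n + 2 < N \<Longrightarrow> f (n + 2) = (x + d) * f (n + 1) - f n"
    and d: "cmod d * (real N)\<^sup>2 \<le> 1 / 2"
    and f1: "1 < N \<Longrightarrow> cmod (f 1) \<le> A * cmod (f 0)"
    and n: "n < N"
  shows "cmod (f n) \<le> 2 * (A + 1) * N * cmod (f 0)"
proof -
  define M where "M = Max ((\<lambda>n. cmod (f n)) ` {..<N})"
  have M: "cmod (f k) \<le> M" if "k < N" for k
    unfolding M_def using that by (intro Max_ge) auto
  have M_in: "M \<in> (\<lambda>n. cmod (f n)) ` {..<N}"
    unfolding M_def using n by (intro Max_in) auto
  have M0: "0 \<le> M" using M[OF n] norm_ge_zero[of "f n"] by linarith
  define w where "w = Complex (x / 2) (sqrt (1 - (x / 2)\<^sup>2))"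
  have x4: "(x / 2)\<^sup>2 \<le> 1" using x by (subst abs_square_le_1) auto
  have w: "cmod w = 1" using x4 by (simp add: w_def cmod_def)
  have w_sum: "complex_of_real x = w + cnj w" by (simp add: w_def complex_eq_iff)
  have w_mult: "cnj w * w = 1"
    using complex_norm_square[of w] w by (simp add: mult.commute)
  \<comment> \<open>With \<open>w + 1/w = x\<close> and \<open>|w| = 1\<close> the second order recurrence splits into two
    first order ones, neither of which amplifies.\<close>
  define g where "g n = f (n + 1) - w * f n" for n
  have g_rec: "g (k + 1) = cnj w * g k + d * f (k + 1)" if "k + 2 < N" for k
  proof -
    have "g (k + 1) = (x + d) * f (k + 1) - f k - w * f (k + 1)"
      using rec[OF that] by (simp add: g_def)
    also have "\<dots> = cnj w * f (k + 1) - (cnj w * w) * f k + d * f (k + 1)"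
    proof -
      have "x * f (k + 1) = w * f (k + 1) + cnj w * f (k + 1)"
        by (simp only: w_sum distrib_right)
      then show ?thesis unfolding w_mult by (simp add: algebra_simps)
    qed
    finally show ?thesis by (simp add: g_def algebra_simps)
  qed
  have g_bound: "k + 1 < N \<Longrightarrow> cmod (g k) \<le> (A + 1) * cmod (f 0) + k * (cmod d * M)" for k
  proof (induction k)
    case 0
    have "cmod (g 0) \<le> cmod (f 1) + cmod (w * f 0)"
      unfolding g_def by (metis norm_triangle_ineq4 add_0)
    then show ?case using f1 0 w by (simp add: norm_mult algebra_simps)
  next
    case (Suc k)
    have "cmod (g (k + 1)) \<le> cmod (cnj w * g k) + cmod (d * f (k + 1))"
      using g_rec[of k] Suc.prems by (simp add: norm_triangle_ineq)
    also have "\<dots> \<le> cmod (g k) + cmod d * M"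
      using M[of "k + 1"] Suc.prems w by (simp add: norm_mult mult_left_mono)
    finally show ?case using Suc by (simp add: algebra_simps)
  qed
  have step: "cmod (f (k + 1)) \<le> cmod (f k) + cmod (g k)" for k
  proof -
    have "f (k + 1) = g k + w * f k" by (simp add: g_def)
    then have "cmod (f (k + 1)) \<le> cmod (g k) + cmod (w * f k)" by (metis norm_triangle_ineq)
    then show ?thesis using w by (simp add: norm_mult)
  qed
  have f_bound: "k < N \<Longrightarrow>
      cmod (f k) \<le> cmod (f 0) + k * ((A + 1) * cmod (f 0) + N * (cmod d * M))" for k
  proof (induction k)
    case (Suc k)
    have "real k * (cmod d * M) \<le> N * (cmod d * M)"
      using Suc.prems M0 by (intro mult_right_mono) auto
    then show ?case using step[of k] g_bound[of k] Suc by (simp add: algebra_simps)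
  qed simp
  obtain k where k: "k < N" "M = cmod (f k)" using M_in by auto
  have "M \<le> cmod (f 0) + k * ((A + 1) * cmod (f 0) + N * (cmod d * M))"
    using f_bound[OF k(1)] k(2) by simp
  \<comment> \<open>The sharper factor \<open>N - 1\<close> leaves room for the separate
    \<open>cmod (f 0)\<close>, since \<open>A + 1 \<ge> 1\<close>.\<close>
  also have "\<dots> \<le> cmod (f 0) + (real N - 1) * ((A + 1) * cmod (f 0)) + N * (N * (cmod d * M))"
  proof -
    have "real k * ((A + 1) * cmod (f 0)) \<le> (real N - 1) * ((A + 1) * cmod (f 0))"
      using k(1) A by (intro mult_right_mono) auto
    moreover have "real k * (N * (cmod d * M)) \<le> N * (N * (cmod d * M))"
      using k(1) M0 by (intro mult_right_mono) auto
    ultimately show ?thesis by (simp add: algebra_simps)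
  qed
  also have "\<dots> \<le> N * ((A + 1) * cmod (f 0)) + (cmod d * (real N)\<^sup>2) * M"
    using A by (simp add: algebra_simps power2_eq_square)
  also have "(cmod d * (real N)\<^sup>2) * M \<le> 1 / 2 * M"
    using d M0 by (intro mult_right_mono)
  finally have "M \<le> 2 * (A + 1) * N * cmod (f 0)" by (simp add: algebra_simps)
  then show ?thesis using M[OF n] by linarith
qed

text \<open>Pairing the equation with \<open>p\<close> turns it into a scalar quadratic in
  \<open>z\<close>. \<open>K\<close> is the quadratic form of the potential; its interaction part
  lies between \<open>0\<close> and \<open>4 * \<xi> * P\<close>, as each site belongs to at most
  two bonds and \<open>|u - v|^2 \<le> 2 |u|^2 + 2 |v|^2\<close>.\<close>

lemma chain_energy_identity:
  fixes \<xi> \<eta> m :: real and g :: "nat \<Rightarrow> real" and z :: complex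
  assumes \<xi>: "0 < \<xi>" and p: "p \<in> carrier_vec N"
    and eqs: "\<And>i. i < N \<Longrightarrow> (tridiag_potential N \<xi> \<eta> *\<^sub>v p) $ i = z * m * (g i - z) * p $ i"
  defines "P \<equiv> \<Sum>i<N. (cmod (p $ i))\<^sup>2" and "G \<equiv> \<Sum>i<N. g i * (cmod (p $ i))\<^sup>2"
  obtains K :: real where "m * z\<^sup>2 * P - m * z * G + K = 0"
    and "\<eta> * P \<le> K" and "K \<le> (\<eta> + 4 * \<xi>) * P"
proof -
  define S where "S = (\<Sum>n = 1..<N. \<xi> * (cmod (p $ (n - 1) - p $ n))\<^sup>2)"
  have shift: "(\<Sum>n = 1..N. \<eta> * (cmod (p $ (n - 1)))\<^sup>2) = \<eta> * P"
    unfolding P_def sum_distrib_left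
    by (rule sum.reindex_bij_witness[of _ Suc "\<lambda>n. n - 1"]) auto
  have "(tridiag_potential N \<xi> \<eta> *\<^sub>v p) \<bullet>c p = complex_of_real (S + (\<Sum>n = 1..N. \<eta> * (cmod (p $ (n - 1)))\<^sup>2))"
    using is_chain_potential_tridiag[of N \<xi> \<eta>] p
    unfolding is_chain_potential_def S_def by blast
  then have "complex_of_real (S + \<eta> * P) = (tridiag_potential N \<xi> \<eta> *\<^sub>v p) \<bullet>c p" unfolding shift by simp
  also have "\<dots> = (\<Sum>i<N. (tridiag_potential N \<xi> \<eta> *\<^sub>v p) $ i * cnj (p $ i))"
    using p by (simp add: scalar_prod_def atLeast0LessThan)
  also have "\<dots> = (\<Sum>i<N. z * m * (g i - z) * (p $ i * cnj (p $ i)))"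
    by (intro sum.cong refl) (use eqs in \<open>simp del: index_mult_mat_vec\<close>)
  also have "\<dots> = m * z * G - m * z\<^sup>2 * P"
    unfolding G_def P_def complex_norm_square[symmetric] of_real_sum of_real_mult
      sum_distrib_left sum_subtractf[symmetric]
    by (intro sum.cong refl) (simp add: algebra_simps power2_eq_square)
  finally have 1: "m * z\<^sup>2 * P - m * z * G + (S + \<eta> * P) = 0" by simp
  have S0: "0 \<le> S" unfolding S_def using \<xi> by (intro sum_nonneg) auto
  have par: "(cmod (u - v))\<^sup>2 \<le> 2 * (cmod u)\<^sup>2 + 2 * (cmod v)\<^sup>2" for u v
  proof -
    have "(cmod (u - v))\<^sup>2 \<le> (cmod u + cmod v)\<^sup>2"
      by (intro power_mono norm_triangle_ineq4) auto
    also have "\<dots> \<le> 2 * (cmod u)\<^sup>2 + 2 * (cmod v)\<^sup>2"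
      using zero_le_power2[of "cmod u - cmod v"] by (simp add: power2_eq_square algebra_simps)
    finally show ?thesis .
  qed
  have "S \<le> (\<Sum>n = 1..<N. \<xi> * (2 * (cmod (p $ (n - 1)))\<^sup>2 + 2 * (cmod (p $ n))\<^sup>2))"
    unfolding S_def using \<xi> par by (intro sum_mono mult_left_mono) auto
  also have "\<dots> = 2 * \<xi> * (\<Sum>n = 1..<N. (cmod (p $ (n - 1)))\<^sup>2) + 2 * \<xi> * (\<Sum>n = 1..<N. (cmod (p $ n))\<^sup>2)"
    by (simp add: sum.distrib sum_distrib_left algebra_simps)
  also have "(\<Sum>n = 1..<N. (cmod (p $ (n - 1)))\<^sup>2) = (\<Sum>n<N - 1. (cmod (p $ n))\<^sup>2)"
    by (rule sum.reindex_bij_witness[of _ Suc "\<lambda>n. n - 1"]) auto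
  also have "2 * \<xi> * (\<Sum>n<N - 1. (cmod (p $ n))\<^sup>2) + 2 * \<xi> * (\<Sum>n = 1..<N. (cmod (p $ n))\<^sup>2)
      \<le> 2 * \<xi> * P + 2 * \<xi> * P"
    unfolding P_def using \<xi> by (intro add_mono mult_left_mono sum_mono2) auto
  finally have "S \<le> 4 * \<xi> * P" by (simp add: mult_ac)
  then show ?thesis using that[of "S + \<eta> * P"] 1 S0 by (simp add: algebra_simps)
qed

text \<open>Isolates what the estimates use of \<open>I\<close> and the frictions, with bounds that
  can be fixed before \<open>N\<close>. Sites are counted from \<open>0\<close>; for
  \<open>N = 1\<close> both ends are site \<open>0\<close>.\<close>

definition end_damped :: "nat \<Rightarrow> real \<Rightarrow> real \<Rightarrow> (nat \<Rightarrow> real) \<Rightarrow> bool" where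
  "end_damped N \<gamma>\<^sub>0 \<gamma>\<^sub>1 g \<longleftrightarrow> (\<forall>i<N. 0 \<le> g i \<and> g i \<le> \<gamma>\<^sub>1) \<and>
     (\<forall>i. 0 < i \<and> i < N - 1 \<longrightarrow> g i = 0) \<and> (\<gamma>\<^sub>0 \<le> g 0 \<or> \<gamma>\<^sub>0 \<le> g (N - 1))"

text \<open>One constant for each of three cases: real \<open>z\<close>, real part above order
  \<open>N^-2\<close>, and the recurrence estimate. Their minimum is fixed before \<open>N\<close>,
  \<open>g\<close>, \<open>z\<close> and \<open>p\<close>.\<close>

lemma eigenvalue_Re_lower_bound:
  fixes \<xi> \<eta> m \<gamma>\<^sub>0 \<gamma>\<^sub>1 :: real
  assumes \<xi>: "0 < \<xi>" and \<eta>: "0 < \<eta>" and m: "0 < m" and \<gamma>: "0 < \<gamma>\<^sub>0" "0 < \<gamma>\<^sub>1"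
  shows "\<exists>c>0. \<forall>N g z p. 1 \<le> N \<and> end_damped N \<gamma>\<^sub>0 \<gamma>\<^sub>1 g \<and> chain_mode N \<xi> \<eta> m g z p
    \<longrightarrow> c / real N ^ 3 \<le> Re z"
proof -
  \<comment> \<open>\<open>L\<close> bounds the modulus of every non-real eigenvalue.
    \<open>A\<close> bounds the ratio of the second amplitude to the first at a damped end:
    \<open>|x| + |d| + 1 \<le> 4\<close>, plus the friction term.\<close>
  define L where "L = sqrt ((\<eta> + 4 * \<xi>) / m)"
  define A where "A = 4 + m * \<gamma>\<^sub>1 * L / \<xi>"
  \<comment> \<open>\<open>c1\<close> serves real \<open>z\<close>; \<open>c2\<close> is the size of
    \<open>a * N^2\<close> up to which \<open>|d| * N^2 \<le> 1/2\<close> holds; \<open>c3\<close>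
    inverts the cubic growth bound on \<open>P\<close>.\<close>
  define c1 c2 c3 where "c1 = \<eta> / (m * \<gamma>\<^sub>1)" and "c2 = \<xi> / (4 * m * L)"
    and "c3 = \<gamma>\<^sub>0 / (8 * (A + 1)\<^sup>2)"
  have L: "0 < L" using \<xi> \<eta> m by (simp add: L_def)
  have A: "0 < A" using \<xi> m \<gamma> L by (simp add: A_def add_pos_nonneg)
  have c123: "0 < c1" "0 < c2" "0 < c3"
    using \<xi> \<eta> m \<gamma> L A by (simp_all add: c1_def c2_def c3_def)
  define c where "c = min c1 (min c2 c3)"
  have "0 < c" using c123 by (simp add: c_def)
  moreover have "c / real N ^ 3 \<le> Re z"
    if N: "1 \<le> N" and damped: "end_damped N \<gamma>\<^sub>0 \<gamma>\<^sub>1 g" and mode: "chain_mode N \<xi> \<eta> m g z p" for N g z p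
  proof -
    have p: "p \<in> carrier_vec N" "p \<noteq> 0\<^sub>v N"
      and eqs: "\<And>i. i < N \<Longrightarrow> (tridiag_potential N \<xi> \<eta> *\<^sub>v p) $ i = z * m * (g i - z) * p $ i"
      using mode by (auto simp: chain_mode_def)
    have g: "\<And>i. i < N \<Longrightarrow> 0 \<le> g i \<and> g i \<le> \<gamma>\<^sub>1" and inner: "\<And>i. 0 < i \<Longrightarrow> i < N - 1 \<Longrightarrow> g i = 0"
      and ends: "\<gamma>\<^sub>0 \<le> g 0 \<or> \<gamma>\<^sub>0 \<le> g (N - 1)"
      using damped by (auto simp: end_damped_def)
    define P where "P = (\<Sum>i<N. (cmod (p $ i))\<^sup>2)"
    define G where "G = (\<Sum>i<N. g i * (cmod (p $ i))\<^sup>2)"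
    obtain K where K: "m * z\<^sup>2 * P - m * z * G + K = 0" "\<eta> * P \<le> K" "K \<le> (\<eta> + 4 * \<xi>) * P"
      by (rule chain_energy_identity[OF \<xi> p(1) eqs, folded P_def G_def])
    have "\<exists>i<N. p $ i \<noteq> 0" using p by (auto simp: vec_eq_iff)
    then have P: "0 < P" unfolding P_def by (auto intro!: sum_pos2)
    have K0: "0 < K" using K(2) P \<eta> by (meson less_le_trans mult_pos_pos)
    have G0: "0 \<le> G" unfolding G_def using g by (intro sum_nonneg) auto
    have G1: "G \<le> \<gamma>\<^sub>1 * P"
      unfolding G_def P_def sum_distrib_left using g by (intro sum_mono mult_right_mono) auto
    define a b where "a = Re z" and "b = Im z"
    have re: "m * P * (a\<^sup>2 - b\<^sup>2) - m * a * G + K = 0"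
      using arg_cong[OF K(1), of Re] by (simp add: a_def b_def power2_eq_square algebra_simps)
    have im: "b * (2 * a * P - G) = 0"
    proof -
      have "m * (b * (2 * a * P - G)) = 0"
        using arg_cong[OF K(1), of Im] by (simp add: a_def b_def power2_eq_square algebra_simps)
      then show ?thesis using m by simp
    qed
    have N3: "x / real N ^ 3 \<le> x" if "0 < x" for x
      using that N by (simp add: divide_le_eq mult_le_cancel_left1)
    have "min c1 (min c2 c3) / real N ^ 3 \<le> a"
    proof (cases "b = 0")
      case True
      \<comment> \<open>For real \<open>z\<close> the term quadratic in \<open>a\<close> has a sign,
        so the friction term dominates \<open>K\<close>; \<open>G \<le> \<gamma>\<^sub>1 * P\<close>
        then keeps \<open>a\<close> away from \<open>0\<close> uniformly in
        \<open>N\<close>.\<close>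
      have "K \<le> a * (m * G)"
      proof -
        have "0 \<le> m * P * a\<^sup>2" using m P by simp
        then show ?thesis using re True by (simp add: algebra_simps)
      qed
      then have aG: "0 < a * (m * G)" using K0 by linarith
      have "0 < G" using aG G0 by (cases "G = 0") auto
      then have a: "0 < a" using aG m by (metis mult_pos_pos zero_less_mult_pos2)
      have "\<eta> * P \<le> a * (m * (\<gamma>\<^sub>1 * P))"
      proof -
        have "a * (m * G) \<le> a * (m * (\<gamma>\<^sub>1 * P))" using a m G1 by (intro mult_left_mono) auto
        then show ?thesis using \<open>K \<le> a * (m * G)\<close> K(2) by linarith
      qed
      then have "\<eta> \<le> a * (m * \<gamma>\<^sub>1)" using P by (simp add: mult.assoc[symmetric])
      then have "c1 \<le> a" using m \<gamma> by (simp add: c1_def pos_divide_le_eq)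
      moreover have "min c1 (min c2 c3) / real N ^ 3 \<le> c1 / real N ^ 3"
        using N by (intro divide_right_mono) auto
      ultimately show ?thesis using N3[OF c123(1)] by linarith
    next
      case False
      then have GaP: "G = 2 * a * P" using im by simp
      have a0: "0 \<le> a" using G0 GaP P by (simp add: zero_le_mult_iff)
      have "P * (m * (a\<^sup>2 + b\<^sup>2)) = K" using re GaP by (simp add: power2_eq_square algebra_simps)
      then have KP: "m * (a\<^sup>2 + b\<^sup>2) = K / P" using P by (simp add: field_simps)
      have KP_bounds: "\<eta> \<le> K / P" "K / P \<le> \<eta> + 4 * \<xi>"
        using K(2,3) P by (simp_all add: field_simps)
      have zL: "cmod z \<le> L"
      proof -
        have "a\<^sup>2 + b\<^sup>2 = (K / P) / m" using m by (simp add: KP[symmetric])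
        also have "\<dots> \<le> (\<eta> + 4 * \<xi>) / m" using KP_bounds m by (intro divide_right_mono) auto
        finally show ?thesis unfolding L_def cmod_def a_def b_def by (rule real_sqrt_le_mono)
      qed
      show ?thesis
      proof (cases "a * (real N)\<^sup>2 \<le> c2")
        case False
        then have "c2 / (real N)\<^sup>2 \<le> a" using N by (simp add: field_simps)
        moreover have "c2 / real N ^ 3 \<le> c2 / (real N)\<^sup>2"
          using N c123 by (intro divide_left_mono power_increasing) auto
        moreover have "min c1 (min c2 c3) / real N ^ 3 \<le> c2 / real N ^ 3"
          using N by (intro divide_right_mono) auto
        ultimately show ?thesis by linarith
      next
        case True
        \<comment> \<open>Since \<open>z^2 = 2 * a * z - |z|^2\<close> and
          \<open>m * |z|^2 = K / P\<close>, the recurrence coefficient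
          \<open>2 + (\<eta> + m * z^2) / \<xi>\<close> splits into a real \<open>x\<close> in
          \<open>[-2, 2]\<close> and a \<open>d\<close> with modulus proportional to
          \<open>a * |z|\<close>.\<close>
        define x where "x = 2 + (\<eta> - K / P) / \<xi>"
        define d where "d = 2 * m * a / \<xi> * z"
        have x: "\<bar>x\<bar> \<le> 2"
          using KP_bounds \<xi> by (auto simp: x_def abs_le_iff field_simps)
        have d: "cmod d * (real N)\<^sup>2 \<le> 1 / 2"
        proof -
          have "cmod d * (real N)\<^sup>2 = (2 * m / \<xi> * cmod z) * (a * (real N)\<^sup>2)"
            using m a0 \<xi> by (simp add: d_def norm_mult norm_divide)
          also have "\<dots> \<le> (2 * m / \<xi> * L) * c2"
            using m \<xi> zL True a0 L by (intro mult_mono) auto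
          also have "\<dots> = 1 / 2" using m \<xi> L by (simp add: c2_def)
          finally show ?thesis .
        qed
        have xd: "\<xi> * (x + d) = 2 * \<xi> + \<eta> + m * z\<^sup>2"
        proof -
          have "m * z\<^sup>2 = 2 * m * a * z - K / P"
            using KP[symmetric]
            by (auto simp: complex_eq_iff a_def[symmetric] b_def[symmetric] power2_eq_square
                algebra_simps)
          moreover have "\<xi> * complex_of_real x = of_real (2 * \<xi> + \<eta> - K / P)"
            unfolding of_real_mult[symmetric] using \<xi> by (simp add: x_def field_simps)
          moreover have "\<xi> * d = 2 * m * a * z" using \<xi> by (simp add: d_def)
          ultimately show ?thesis by (simp add: distrib_left)
        qed
        \<comment> \<open>\<open>f\<close> lists the amplitudes inward from a damped end with
          friction \<open>h\<close>, so that one argument covers both ends. Summing the squared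
          growth bound gives \<open>P\<close> at most of order \<open>N^3 * |f 0|^2\<close>, while
          \<open>G\<close> is at least \<open>h * |f 0|^2\<close>.\<close>
        have one_end: "G \<ge> P * (2 * c3 / real N ^ 3)"
          if f: "\<And>n. n + 2 < N \<Longrightarrow> f (n + 2) = (x + d) * f (n + 1) - f n"
            and f1: "1 < N \<Longrightarrow> \<xi> * f 1 = (\<xi> * (x + d) - \<xi> - m * h * z) * f 0"
            and h: "\<gamma>\<^sub>0 \<le> h" "h \<le> \<gamma>\<^sub>1" and fP: "P = (\<Sum>n<N. (cmod (f n))\<^sup>2)"
            and hG: "h * (cmod (f 0))\<^sup>2 \<le> G" for f :: "nat \<Rightarrow> complex" and h :: real
        proof -
          have f1': "cmod (f 1) \<le> A * cmod (f 0)" if "1 < N"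
          proof -
            have d1: "cmod d \<le> 1"
            proof -
              have "cmod d * 1 \<le> cmod d * (real N)\<^sup>2"
                using N by (intro mult_left_mono) auto
              then show ?thesis using d by linarith
            qed
            have "f 1 = (x + d - 1 - m * h * z / \<xi>) * f 0"
              using f1[OF that] \<xi> by (simp add: field_simps)
            then have "cmod (f 1) = cmod (x + d - 1 - m * h * z / \<xi>) * cmod (f 0)"
              by (simp add: norm_mult)
            also have "cmod (x + d - 1 - m * h * z / \<xi>)
                \<le> cmod (of_real x) + cmod d + cmod 1 + cmod (m * h * z / \<xi>)"
              by (smt (verit) norm_triangle_ineq norm_triangle_ineq4)
            also have "cmod (m * h * z / \<xi>) = m * h / \<xi> * cmod z"
              using m h \<gamma> \<xi> by (simp add: norm_mult norm_divide)
            also have "\<dots> \<le> m * \<gamma>\<^sub>1 / \<xi> * L"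
              using m h \<gamma> \<xi> zL by (intro mult_mono divide_right_mono) auto
            finally have "cmod (f 1) \<le> (cmod (of_real x) + cmod d + cmod 1 + m * \<gamma>\<^sub>1 / \<xi> * L) * cmod (f 0)"
              by (simp add: mult_right_mono)
            also have "\<dots> \<le> A * cmod (f 0)"
              using x d1 by (intro mult_right_mono) (auto simp: A_def)
            finally show ?thesis .
          qed
          have "P \<le> (\<Sum>n<N. (2 * (A + 1) * N * cmod (f 0))\<^sup>2)"
            unfolding fP using perturbed_recurrence_growth[OF x _ f d f1'] A
            by (intro sum_mono power_mono) auto
          also have "\<dots> = 4 * (A + 1)\<^sup>2 * real N ^ 3 * (cmod (f 0))\<^sup>2"
            by (simp add: power2_eq_square power3_eq_cube algebra_simps)
          finally have "P * (2 * c3 / real N ^ 3)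
              \<le> (4 * (A + 1)\<^sup>2 * real N ^ 3 * (cmod (f 0))\<^sup>2) * (2 * c3 / real N ^ 3)"
            using c123 by (intro mult_right_mono) auto
          also have "\<dots> = \<gamma>\<^sub>0 * (cmod (f 0))\<^sup>2" using N A by (simp add: c3_def)
          also have "\<dots> \<le> h * (cmod (f 0))\<^sup>2" using h by (intro mult_right_mono) auto
          finally show ?thesis using hG by linarith
        qed
        have row: "\<eta> * p $ i + (if 0 < i then \<xi> * (p $ i - p $ (i - 1)) else 0)
            + (if Suc i < N then \<xi> * (p $ i - p $ Suc i) else 0) = z * m * (g i - z) * p $ i"
          if "i < N" for i
          using eqs[OF that] tridiag_mult_vec[OF p(1) that] by simp
        have inner_row: "p $ (i + 1) + p $ (i - 1) = (x + d) * p $ i" if "0 < i" "i < N - 1" for i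
        proof -
          have "\<xi> * (p $ (i + 1) + p $ (i - 1)) = (2 * \<xi> + \<eta> + m * z\<^sup>2) * p $ i"
          proof -
            have i: "i < N" "Suc i < N" using that by auto
            have "\<eta> * p $ i + \<xi> * (p $ i - p $ (i - 1)) + \<xi> * (p $ i - p $ (i + 1)) = - m * z\<^sup>2 * p $ i"
              using row[OF i(1)] inner[OF that] that i by (simp add: power2_eq_square mult_ac)
            then show ?thesis by (simp add: algebra_simps add_eq_0_iff)
          qed
          also have "\<dots> = \<xi> * ((x + d) * p $ i)" using xd by (simp add: mult.assoc[symmetric])
          finally show ?thesis using \<xi> by simp
        qed
        have G_ge: "g i * (cmod (p $ i))\<^sup>2 \<le> G" if "i < N" for i
          unfolding G_def using that g by (intro member_le_sum) auto
        from ends have "G \<ge> P * (2 * c3 / real N ^ 3)"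
        proof
          assume h: "\<gamma>\<^sub>0 \<le> g 0"
          show ?thesis
          proof (rule one_end[of "\<lambda>n. p $ n" "g 0"])
            show "p $ (n + 2) = (x + d) * p $ (n + 1) - p $ n" if "n + 2 < N" for n
              using inner_row[of "n + 1"] that by (simp add: algebra_simps)
            show "\<xi> * p $ 1 = (\<xi> * (x + d) - \<xi> - m * g 0 * z) * p $ 0" if "1 < N"
              using row[of 0] that unfolding xd by (simp add: algebra_simps power2_eq_square)
          qed (use h g[of 0] G_ge[of 0] N P_def in auto)
        next
          assume h: "\<gamma>\<^sub>0 \<le> g (N - 1)"
          show ?thesis
          proof (rule one_end[of "\<lambda>n. p $ (N - 1 - n)" "g (N - 1)"])
            show "p $ (N - 1 - (n + 2)) = (x + d) * p $ (N - 1 - (n + 1)) - p $ (N - 1 - n)"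
              if n: "n + 2 < N" for n
            proof -
              have "N - 1 - (n + 1) + 1 = N - 1 - n" "N - 1 - (n + 1) - 1 = N - 1 - (n + 2)"
                using n by auto
              then show ?thesis using inner_row[of "N - 1 - (n + 1)"] n by (simp add: algebra_simps)
            qed
            show "\<xi> * p $ (N - 1 - 1) = (\<xi> * (x + d) - \<xi> - m * g (N - 1) * z) * p $ (N - 1 - 0)"
              if "1 < N"
              using row[of "N - 1"] that unfolding xd by (simp add: algebra_simps power2_eq_square)
            show "P = (\<Sum>n<N. (cmod (p $ (N - 1 - n)))\<^sup>2)"
              unfolding P_def
              by (rule sum.reindex_bij_witness[of _ "\<lambda>n. N - 1 - n" "\<lambda>n. N - 1 - n"]) auto
          qed (use h g[of "N - 1"] G_ge[of "N - 1"] N in auto)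
        qed
        then have "P * (2 * c3 / real N ^ 3) \<le> P * (2 * a)" using GaP by (simp add: mult_ac)
        then have "2 * c3 / real N ^ 3 \<le> 2 * a" using P by (simp only: mult_le_cancel_left_pos)
        then have "c3 / real N ^ 3 \<le> a" by simp
        moreover have "min c1 (min c2 c3) / real N ^ 3 \<le> c3 / real N ^ 3"
          using N by (intro divide_right_mono) auto
        ultimately show ?thesis by linarith
      qed
    qed
    then show ?thesis by (simp add: c_def a_def)
  qed
  ultimately show ?thesis by blast
qed

section \<open>Chebyshev polynomials at the band edge\<close>

text \<open>\<open>cheb x (n + 1)\<close> is the Chebyshev polynomial of the second kind \<open>U\<^sub>n(x / 2)\<close>.\<close>

fun cheb :: "'a::comm_ring_1 \<Rightarrow> nat \<Rightarrow> 'a" where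
  "cheb x 0 = 0"
| "cheb x (Suc 0) = 1"
| "cheb x (Suc (Suc n)) = x * cheb x (Suc n) - cheb x n"

lemma poly_cheb: "poly (cheb p n) x = cheb (poly p x) n"
  by (induction p n rule: cheb.induct) auto

lemma of_real_cheb: "of_real (cheb x n) = cheb (of_real x :: complex) n"
  by (induction x n rule: cheb.induct) auto

text \<open>The sines obey the same recurrence by the product-to-sum formula. The parameter
  \<open>- 2 * cos t\<close> puts the band edge \<open>x = -2\<close> at \<open>t = 0\<close>, and
  the factor \<open>sin t\<close> avoids a division.\<close>

lemma cheb_trig: "cheb (- 2 * cos t) n * sin t = (- 1) ^ Suc n * sin (real n * t)"
proof (induction n rule: induct_nat_012)
  case (ge2 n)
  have "cheb (- 2 * cos t) (Suc (Suc n)) * sin t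
      = - 2 * cos t * (cheb (- 2 * cos t) (Suc n) * sin t) - cheb (- 2 * cos t) n * sin t"
    by (simp add: algebra_simps)
  also have "\<dots> = (- 1) ^ Suc (Suc (Suc n)) * (2 * cos t * sin (real (Suc n) * t) - sin (real n * t))"
    unfolding ge2 by (simp add: algebra_simps)
  also have "2 * cos t * sin (real (Suc n) * t) - sin (real n * t) = sin (real (Suc (Suc n)) * t)"
    using sin_times_cos[of "real (Suc n) * t" t] by (simp add: algebra_simps)
  finally show ?case .
qed auto

text \<open>For \<open>x = 2 + (\<eta> + m z\<^sup>2) / \<xi>\<close> this is, up to scaling, the determinant of \<open>m z\<^sup>2 + B\<close> with one
  terminal site deleted.\<close>

definition end_minor :: "nat \<Rightarrow> real \<Rightarrow> real" where
  "end_minor N x = cheb x N - cheb x (N - 1)"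

text \<open>Sum-to-product combines the two sines, and a common \<open>2 * cos (t / 2)\<close>
  cancels. The zeros become visible: \<open>(N - 1/2) * t\<close> is a multiple of
  \<open>pi\<close>.\<close>

lemma end_minor_trig:
  assumes N: "1 \<le> N" and t: "cos (t / 2) \<noteq> 0" "sin (t / 2) \<noteq> 0"
  shows "end_minor N (- 2 * cos t) * sin (t / 2) = (- 1) ^ Suc N * sin ((real N - 1 / 2) * t)"
proof -
  obtain k where k: "N = Suc k" using N by (cases N) auto
  have "end_minor N (- 2 * cos t) * sin t
      = (- 1) ^ Suc N * (sin (real N * t) + sin (real k * t))"
    unfolding end_minor_def k diff_Suc_1 left_diff_distrib cheb_trig by (simp add: ring_distribs)
  also have "sin (real N * t) + sin (real k * t) = 2 * sin ((real N - 1 / 2) * t) * cos (t / 2)"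
    by (subst sin_plus_sin) (simp add: k algebra_simps add_divide_distrib)
  also have "sin t = 2 * sin (t / 2) * cos (t / 2)" using sin_double[of "t / 2"] by simp
  finally have "(2 * cos (t / 2)) * (end_minor N (- 2 * cos t) * sin (t / 2))
      = (2 * cos (t / 2)) * ((- 1) ^ Suc N * sin ((real N - 1 / 2) * t))"
    by (simp only: mult_ac)
  then show ?thesis using t by (subst (asm) mult_cancel_left) auto
qed

lemma end_minor_DERIV:
  "(end_minor N has_real_derivative
     poly (pderiv (cheb [:0, 1:] N - cheb [:0, 1:] (N - 1))) x) (at x)"
proof -
  have "end_minor N = poly (cheb [:0, 1:] N - cheb [:0, 1:] (N - 1))"
    by (rule ext) (simp add: end_minor_def poly_cheb)
  then show ?thesis by (simp add: poly_DERIV)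
qed

text \<open>The factor \<open>x\<close> outweighs the subtracted predecessor. As consecutive values
  then differ, \<open>end_minor\<close> has no zero there.\<close>

lemma cheb_abs_growth:
  fixes x :: real
  assumes "2 \<le> \<bar>x\<bar>"
  shows "\<bar>cheb x n\<bar> < \<bar>cheb x (Suc n)\<bar>"
proof (induction n)
  case (Suc n)
  have "2 * \<bar>cheb x (Suc n)\<bar> \<le> \<bar>x * cheb x (Suc n)\<bar>"
    unfolding abs_mult using assms by (intro mult_right_mono) auto
  then show ?case using Suc by simp
qed simp

text \<open>For \<open>x \<le> -2\<close> the growth of \<open>cheb\<close> decides; otherwise
  \<open>x = -2 * cos t\<close> with \<open>t\<close> so small that \<open>(N - 1/2) * t\<close>
  stays in \<open>(0, pi)\<close>, where the sine is positive.\<close>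

lemma end_minor_nonzero:
  assumes N: "2 \<le> N" and x: "x < - 2 * cos (2 * pi / (2 * real N - 1))"
  shows "end_minor N x \<noteq> 0"
proof (cases "x \<le> - 2")
  case True
  then show ?thesis using cheb_abs_growth[of x "N - 1"] N by (auto simp: end_minor_def)
next
  case False
  define c where "c = - x / 2"
  define s where "s = 2 * pi / (2 * real N - 1)"
  define t where "t = arccos c"
  have s: "0 < s" "s \<le> pi" using N by (auto simp: s_def field_simps)
  have c: "cos s < c" "c < 1" "-1 \<le> c"
    using x False cos_ge_minus_one[of s] unfolding c_def s_def[symmetric] by linarith+
  have ct: "cos t = c" using c by (simp add: t_def)
  have t0: "0 < t" "t < s"
    using c s arccos_lt_bounded[of c] arccos_less_mono[of c "cos s"] arccos_cos[of s]
      cos_ge_minus_one[of s]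
    by (auto simp: t_def abs_le_iff)
  have sc: "0 < cos (t / 2)" "0 < sin (t / 2)"
    using t0 s by (auto intro!: cos_gt_zero sin_gt_zero)
  have "(real N - 1 / 2) * t < (real N - 1 / 2) * s"
    using t0 N by (intro mult_strict_left_mono) auto
  also have "\<dots> = pi" using N by (simp add: s_def field_simps)
  finally have "0 < sin ((real N - 1 / 2) * t)" using t0 N by (intro sin_gt_zero) auto
  moreover have "end_minor N x * sin (t / 2) = (- 1) ^ Suc N * sin ((real N - 1 / 2) * t)"
    using end_minor_trig[of N t] N sc ct by (simp add: c_def)
  ultimately show ?thesis by auto
qed

text \<open>At \<open>t = 2 * pi / (2 * N - 1)\<close> the angle \<open>(N - 1/2) * t\<close> is
  \<open>pi\<close>, which gives the zero nearest to the edge \<open>-2\<close>. Differentiating the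
  trigonometric form there equates \<open>N - 1/2\<close> with \<open>|D|\<close> times a factor at
  most \<open>t^2\<close>; as \<open>t\<close> is of order \<open>1 / N\<close>, \<open>|D|\<close>
  is at least of order \<open>N^3\<close>.\<close>

lemma end_minor_top_zero:
  assumes N: "2 \<le> N"
  defines "x \<equiv> - 2 * cos (2 * pi / (2 * real N - 1))"
  shows "end_minor N x = 0" and "\<bar>cheb x N\<bar> \<le> 1"
    and "real N ^ 3 / (8 * pi\<^sup>2) \<le>
      \<bar>poly (pderiv (cheb [:0, 1:] N - cheb [:0, 1:] (N - 1))) x\<bar>"
proof -
  define s where "s = 2 * pi / (2 * real N - 1)"
  have xs: "x = - 2 * cos s" by (simp add: x_def s_def)
  have s: "0 < s" "s \<le> 2 * pi / 3" using N by (auto simp: s_def field_simps)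
  have sN: "(real N - 1 / 2) * s = pi" using N by (simp add: s_def field_simps)
  have sc: "0 < cos (s / 2)" "0 < sin (s / 2)"
    using s by (auto intro!: cos_gt_zero sin_gt_zero)
  show zero: "end_minor N x = 0"
    using end_minor_trig[of N s] N sc by (simp add: xs sN)
  show "\<bar>cheb x N\<bar> \<le> 1"
  proof -
    \<comment> \<open>The shift by \<open>pi\<close> reduces \<open>|cheb x N|\<close> to
      \<open>1 / (2 * cos (s / 2))\<close>, and \<open>N \<ge> 2\<close> keeps \<open>s / 2\<close>
      at most \<open>pi / 3\<close>.\<close>
    have "real N * s = pi + s / 2" using sN by (simp add: algebra_simps)
    then have "\<bar>cheb x N\<bar> * \<bar>sin s\<bar> = \<bar>sin (s / 2)\<bar>"
      using arg_cong[OF cheb_trig[of s N], of abs] by (simp add: xs abs_mult power_abs)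
    moreover have "sin s = 2 * sin (s / 2) * cos (s / 2)" using sin_double[of "s / 2"] by simp
    ultimately have 1: "\<bar>cheb x N\<bar> * (2 * cos (s / 2)) = 1"
      using sc by (simp add: abs_mult)
    have "cos (pi / 3) \<le> cos (s / 2)"
      using s by (intro cos_monotone_0_pi_le) auto
    then have "\<bar>cheb x N\<bar> * 1 \<le> \<bar>cheb x N\<bar> * (2 * cos (s / 2))"
      by (intro mult_left_mono) (auto simp: cos_60)
    then show ?thesis using 1 by simp
  qed
  define D where "D = poly (pderiv (cheb [:0, 1:] N - cheb [:0, 1:] (N - 1))) x"
  have d1: "((\<lambda>t. end_minor N (- 2 * cos t) * sin (t / 2)) has_real_derivative
      D * (2 * sin s) * sin (s / 2)) (at s)"
  proof -
    have "(end_minor N has_real_derivative D) (at (- 2 * cos s))"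
      using end_minor_DERIV[of N x] unfolding D_def xs .
    then have "((\<lambda>t. end_minor N (- 2 * cos t)) has_real_derivative D * (2 * sin s)) (at s)"
      by (rule DERIV_chain2) (auto intro!: derivative_eq_intros)
    moreover have "((\<lambda>t. sin (t / 2)) has_real_derivative cos (s / 2) / 2) (at s)"
      by (auto intro!: derivative_eq_intros)
    ultimately show ?thesis
      using DERIV_mult[of "\<lambda>t. end_minor N (- 2 * cos t)" "D * (2 * sin s)" s UNIV
          "\<lambda>t. sin (t / 2)" "cos (s / 2) / 2"] zero[unfolded xs] by simp
  qed
  have d2: "((\<lambda>t. (- 1) ^ Suc N * sin ((real N - 1 / 2) * t)) has_real_derivative
      (- 1) ^ N * (real N - 1 / 2)) (at s)"
  proof -
    have "((\<lambda>t. (- 1) ^ Suc N * sin ((real N - 1 / 2) * t)) has_real_derivative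
        (- 1) ^ Suc N * (cos ((real N - 1 / 2) * s) * (real N - 1 / 2))) (at s)"
      by (auto intro!: derivative_eq_intros)
    moreover have "(- 1) ^ Suc N * (cos pi * (real N - 1 / 2)) = (- 1) ^ N * (real N - 1 / 2)"
      by (simp add: algebra_simps)
    ultimately show ?thesis by (simp only: sN)
  qed
  \<comment> \<open>The identity was proved for nonzero half-angle sine and cosine, so the two
    functions are compared only near \<open>s\<close>, which suffices for their derivatives.\<close>
  have "\<forall>\<^sub>F t in nhds s. t \<in> {0<..<pi}"
    using s pi_gt_zero by (intro eventually_nhds_in_open) auto
  then have "\<forall>\<^sub>F t in nhds s. end_minor N (- 2 * cos t) * sin (t / 2)
      = (- 1) ^ Suc N * sin ((real N - 1 / 2) * t)"
  proof (rule eventually_mono)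
    fix t :: real assume t: "t \<in> {0<..<pi}"
    then have "0 < cos (t / 2)" "0 < sin (t / 2)" by (auto intro!: cos_gt_zero sin_gt_zero)
    then show "end_minor N (- 2 * cos t) * sin (t / 2) = (- 1) ^ Suc N * sin ((real N - 1 / 2) * t)"
      using end_minor_trig[of N t] N by simp
  qed
  then have "((\<lambda>t. end_minor N (- 2 * cos t) * sin (t / 2)) has_real_derivative
      (- 1) ^ N * (real N - 1 / 2)) (at s)"
    by (rule DERIV_cong_ev[OF refl _ refl, THEN iffD2, OF _ d2])
  with d1 have eqD: "D * (2 * sin s) * sin (s / 2) = (- 1) ^ N * (real N - 1 / 2)"
    by (rule DERIV_unique)
  have sin_s: "0 < sin s" using s pi_gt_zero by (intro sin_gt_zero) linarith+
  have "\<bar>D\<bar> * (2 * sin s * sin (s / 2)) = \<bar>D * (2 * sin s) * sin (s / 2)\<bar>"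
    using sin_s sc by (simp add: abs_mult)
  also have "\<dots> = \<bar>(- 1) ^ N * (real N - 1 / 2)\<bar>" by (simp only: eqD)
  also have "\<dots> = real N - 1 / 2" using N by (simp add: abs_mult power_abs)
  finally have D: "\<bar>D\<bar> * (2 * sin s * sin (s / 2)) = real N - 1 / 2" .
  have "2 * sin s * sin (s / 2) \<le> 2 * s * (s / 2)"
    using s sc sin_s sin_x_le_x[of s] sin_x_le_x[of "s / 2"] by (intro mult_mono) auto
  then have "\<bar>D\<bar> * (2 * sin s * sin (s / 2)) \<le> \<bar>D\<bar> * (2 * s * (s / 2))"
    by (intro mult_left_mono) auto
  then have "(real N - 1 / 2) \<le> \<bar>D\<bar> * s\<^sup>2" unfolding D by (simp add: power2_eq_square)
  moreover have "(real N - 1 / 2) = pi / s" using sN s by (simp add: field_simps)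
  ultimately have "pi / s ^ 3 \<le> \<bar>D\<bar>"
    using s by (simp add: field_simps power2_eq_square power3_eq_cube)
  moreover have "real N ^ 3 / (8 * pi\<^sup>2) \<le> pi / s ^ 3"
  proof -
    have "pi / s ^ 3 = (2 * real N - 1) ^ 3 / (8 * pi\<^sup>2)"
      by (simp add: s_def power_divide power_mult_distrib power2_eq_square power3_eq_cube)
    moreover have "real N ^ 3 \<le> (2 * real N - 1) ^ 3" using N by (intro power_mono) auto
    ultimately show ?thesis by (simp add: divide_right_mono)
  qed
  ultimately show "real N ^ 3 / (8 * pi\<^sup>2) \<le>
      \<bar>poly (pderiv (cheb [:0, 1:] N - cheb [:0, 1:] (N - 1))) x\<bar>"
    unfolding D_def by linarith
qed

section \<open>The argument along the imaginary axis\<close>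

text \<open>In the mean value theorem the intermediate point \<open>u\<close> is within
  \<open>1\<close> of \<open>t\<close>, and \<open>(u - 2 * t)^2 \<ge> 0\<close> yields
  \<open>1 + u^2 \<le> 3 * (1 + t^2)\<close>.\<close>

lemma arctan_increment_ge:
  assumes h: "0 < h" "h \<le> 1"
  shows "h / (3 * (1 + t\<^sup>2)) \<le> arctan (t + h) - arctan t"
proof -
  have "\<exists>u>t. u < t + h \<and> arctan (t + h) - arctan t = (t + h - t) * inverse (1 + u\<^sup>2)"
    using h by (intro MVT2 DERIV_arctan) auto
  then obtain u where u: "t < u" "u < t + h"
    and eq: "arctan (t + h) - arctan t = h * inverse (1 + u\<^sup>2)" by auto
  define v where "v = (u - t)\<^sup>2"
  have "u\<^sup>2 \<le> 2 * t\<^sup>2 + 2 * v"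
    using zero_le_power2[of "u - 2 * t"] by (simp add: v_def power2_eq_square algebra_simps)
  moreover have "v \<le> 1" unfolding v_def using u h by (intro power_le_one) auto
  ultimately have "1 + u\<^sup>2 \<le> 3 + 3 * t\<^sup>2" using zero_le_power2[of t] by linarith
  then have "h / (3 * (1 + t\<^sup>2)) \<le> h / (1 + u\<^sup>2)"
    using h by (intro divide_left_mono mult_pos_pos) (auto simp: add_pos_nonneg distrib_left)
  then show ?thesis using eq by (simp add: divide_inverse)
qed

lemma imaginary_axis_factor:
  assumes "0 < Re z"
  shows "\<i> * complex_of_real s - z
    = - complex_of_real (Re z * sqrt (1 + ((s - Im z) / Re z)\<^sup>2)) * cis (- arctan ((s - Im z) / Re z))"
proof -
  have "sqrt (1 + ((s - Im z) / Re z)\<^sup>2) \<noteq> 0"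
    by (smt (verit) real_sqrt_gt_zero zero_le_power2)
  then show ?thesis using assms by (auto simp: complex_eq_iff cos_arctan sin_arctan)
qed

text \<open>Multiplies the polar forms of the linear factors. The sum of arctangents is not reduced
  modulo \<open>2 * pi\<close>: it is a branch of the argument that is continuous in
  \<open>s\<close>, as the intermediate value theorem requires later.\<close>

lemma imaginary_axis_prod:
  assumes "\<And>z. z \<in> set zs \<Longrightarrow> 0 < Re z"
  shows "\<exists>r>0. (\<Prod>z\<leftarrow>zs. \<i> * complex_of_real s - z)
    = (- 1) ^ length zs * complex_of_real r * cis (- (\<Sum>z\<leftarrow>zs. arctan ((s - Im z) / Re z)))"
  using assms
proof (induction zs)
  case Nil
  then show ?case by (auto intro!: exI[of _ 1])
next
  case (Cons z zs)
  obtain r where r: "0 < r" "(\<Prod>z\<leftarrow>zs. \<i> * complex_of_real s - z)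
    = (- 1) ^ length zs * complex_of_real r * cis (- (\<Sum>z\<leftarrow>zs. arctan ((s - Im z) / Re z)))"
    using Cons by auto
  define t where "t = (s - Im z) / Re z"
  have z: "0 < Re z" using Cons.prems by simp
  have "0 < Re z * sqrt (1 + t\<^sup>2) * r"
    using z r(1) by (intro mult_pos_pos) (auto simp: add_pos_nonneg)
  moreover have "(\<Prod>z\<leftarrow>z # zs. \<i> * complex_of_real s - z)
    = (- 1) ^ length (z # zs) * complex_of_real (Re z * sqrt (1 + t\<^sup>2) * r)
      * cis (- (\<Sum>z\<leftarrow>z # zs. arctan ((s - Im z) / Re z)))"
  proof -
    have "cis (- (\<Sum>z\<leftarrow>z # zs. arctan ((s - Im z) / Re z)))
      = cis (- arctan t) * cis (- (\<Sum>z\<leftarrow>zs. arctan ((s - Im z) / Re z)))"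
      by (simp add: cis_mult t_def)
    then show ?thesis
      using r(2) imaginary_axis_factor[OF z, of s] by (simp add: t_def)
  qed
  ultimately show ?case by blast
qed

text \<open>The sum is the rate at \<open>s0\<close> of the increasing phase
  \<open>\<theta>\<close>. A gain of \<open>pi\<close> would make the imaginary part vanish again
  beyond \<open>s0\<close>; over a step of length \<open>a\<close> the gain is at least a third of
  \<open>a\<close> times the rate, because \<open>a / Re z \<le> 1\<close> for every root.\<close>

lemma phase_bound:
  fixes zs :: "complex list" and a s0 :: real and c :: complex
  assumes a: "0 < a" and zs: "\<And>z. z \<in> set zs \<Longrightarrow> a \<le> Re z" and c: "c \<noteq> 0"
    and im0: "Im (c * (\<Prod>z\<leftarrow>zs. \<i> * complex_of_real s0 - z)) = 0"
    and im: "\<And>s. s0 < s \<Longrightarrow> Im (c * (\<Prod>z\<leftarrow>zs. \<i> * complex_of_real s - z)) \<noteq> 0"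
  shows "a * (\<Sum>z\<leftarrow>zs. Re z / (cmod (\<i> * s0 - z))\<^sup>2) \<le> 3 * pi"
proof -
  have pos: "0 < Re z" if "z \<in> set zs" for z using zs[OF that] a by simp
  define \<theta> where "\<theta> s = (\<Sum>z\<leftarrow>zs. arctan ((s - Im z) / Re z))" for s
  define Q where "Q s = c * (\<Prod>z\<leftarrow>zs. \<i> * complex_of_real s - z)" for s
  have sin: "sin (\<theta> s - \<theta> s0) \<noteq> 0" if s: "s0 < s" for s
  proof
    assume sin0: "sin (\<theta> s - \<theta> s0) = 0"
    obtain r where r: "0 < r" "Q s = c * ((- 1) ^ length zs * complex_of_real r * cis (- \<theta> s))"
      using imaginary_axis_prod[OF pos, where zs = zs and s = s] unfolding Q_def \<theta>_def by metis
    obtain r0 where r0: "0 < r0"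
      "Q s0 = c * ((- 1) ^ length zs * complex_of_real r0 * cis (- \<theta> s0))"
      using imaginary_axis_prod[OF pos, where zs = zs and s = s0] unfolding Q_def \<theta>_def by metis
    have "cis (- \<theta> s) = cis (- \<theta> s0) * cis (- (\<theta> s - \<theta> s0))" by (simp add: cis_mult)
    then have "Q s = Q s0 * complex_of_real (r / r0) * cis (- (\<theta> s - \<theta> s0))"
      using r(2) r0 by simp
    then have "Im (Q s) = 0" using im0 sin0 sin_minus[of "\<theta> s - \<theta> s0"] unfolding Q_def[symmetric] by simp
    then show False using im[OF s] unfolding Q_def[symmetric] by simp
  qed
  have "\<theta> (s0 + a) - \<theta> s0 < pi"
  proof (rule ccontr)
    assume "\<not> ?thesis"
    then have "\<exists>s. s0 \<le> s \<and> s \<le> s0 + a \<and> \<theta> s - \<theta> s0 = pi"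
    proof (intro IVT)
      have "isCont \<theta> s" for s
        unfolding \<theta>_def
      proof (induction zs)
        case (Cons z zs)
        then show ?case by (auto intro!: continuous_intros simp: divide_inverse)
      qed simp
      then show "\<forall>s. s0 \<le> s \<and> s \<le> s0 + a \<longrightarrow> isCont (\<lambda>s. \<theta> s - \<theta> s0) s"
        by (auto intro!: continuous_intros)
    qed (use a in auto)
    then obtain s where s: "s0 \<le> s" "\<theta> s - \<theta> s0 = pi" by blast
    then have "s \<noteq> s0" using pi_gt_zero by auto
    then show False using sin[of s] s by simp
  qed
  moreover have "a / 3 * (\<Sum>z\<leftarrow>zs. Re z / (cmod (\<i> * s0 - z))\<^sup>2) \<le> \<theta> (s0 + a) - \<theta> s0"
  proof -
    have "a / 3 * (Re z / (cmod (\<i> * s0 - z))\<^sup>2)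
      \<le> arctan ((s0 + a - Im z) / Re z) - arctan ((s0 - Im z) / Re z)" if "z \<in> set zs" for z
    proof -
      define t where "t = (s0 - Im z) / Re z"
      have z: "0 < Re z" "a \<le> Re z" using that pos zs by auto
      have "(cmod (\<i> * s0 - z))\<^sup>2 = (Re z)\<^sup>2 + (s0 - Im z)\<^sup>2" by (simp add: cmod_power2)
      also have "\<dots> = (Re z)\<^sup>2 * (1 + t\<^sup>2)"
        using z by (simp add: t_def power_divide algebra_simps)
      finally have "a / 3 * (Re z / (cmod (\<i> * s0 - z))\<^sup>2) = a / Re z / (3 * (1 + t\<^sup>2))"
        using z by (simp add: power2_eq_square)
      also have "\<dots> \<le> arctan (t + a / Re z) - arctan t"
        using z a by (intro arctan_increment_ge) auto
      also have "t + a / Re z = (s0 + a - Im z) / Re z"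
        by (simp add: t_def add_divide_distrib diff_divide_distrib)
      finally show ?thesis by (simp add: t_def)
    qed
    then show ?thesis
      unfolding \<theta>_def sum_list_const_mult[symmetric] sum_list_subtractf[symmetric]
      by (rule sum_list_mono)
  qed
  ultimately show ?thesis by simp
qed

lemma poly_pderiv_prod_roots:
  fixes w :: "'a::field"
  assumes "\<And>z. z \<in> set zs \<Longrightarrow> w \<noteq> z"
  shows "poly (pderiv (\<Prod>z\<leftarrow>zs. [:- z, 1:])) w
    = poly (\<Prod>z\<leftarrow>zs. [:- z, 1:]) w * (\<Sum>z\<leftarrow>zs. 1 / (w - z))"
  using assms
proof (induction zs)
  case (Cons z zs)
  define P where "P = (\<Prod>z\<leftarrow>zs. [:- z, 1:])"
  have wz: "w - z \<noteq> 0" using Cons.prems by auto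
  have "pderiv ([:- z, 1:] * P) = [:- z, 1:] * pderiv P + P"
    by (simp only: pderiv_mult) (simp add: pderiv_pCons)
  then have "poly (pderiv ([:- z, 1:] * P)) w = poly ([:- z, 1:] * pderiv P + P) w"
    by (simp only:)
  also have "\<dots> = (w - z) * (poly P w * (\<Sum>z\<leftarrow>zs. 1 / (w - z))) + poly P w"
    using Cons unfolding P_def[symmetric] by (simp add: algebra_simps)
  also have "\<dots> = (w - z) * poly P w * (1 / (w - z) + (\<Sum>z\<leftarrow>zs. 1 / (w - z)))"
    using wz by (simp add: field_simps)
  also have "(w - z) * poly P w = poly (\<Prod>z\<leftarrow>z # zs. [:- z, 1:]) w"
    by (simp add: P_def algebra_simps)
  finally show ?case by (simp add: P_def)
qed simp

text \<open>The chain rule produces a factor \<open>i\<close>, which exchanges real and imaginary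
  parts. Both claims share one induction, since the step for each uses the other.\<close>

lemma DERIV_poly_imaginary_axis:
  "((\<lambda>s. Im (poly p (\<i> * complex_of_real s))) has_real_derivative
     Re (poly (pderiv p) (\<i> * complex_of_real s))) (at s)"
  "((\<lambda>s. Re (poly p (\<i> * complex_of_real s))) has_real_derivative
     - Im (poly (pderiv p) (\<i> * complex_of_real s))) (at s)"
proof -
  define f where "f p s = poly p (\<i> * complex_of_real s)" for p s
  have "((\<lambda>s. Im (f p s)) has_real_derivative Re (f (pderiv p) s)) (at s) \<and>
    ((\<lambda>s. Re (f p s)) has_real_derivative - Im (f (pderiv p) s)) (at s)"
  proof (induction p)
    case (pCons c p)
    then have IH: "((\<lambda>s. Im (f p s)) has_real_derivative Re (f (pderiv p) s)) (at s)"
      "((\<lambda>s. Re (f p s)) has_real_derivative - Im (f (pderiv p) s)) (at s)" by auto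
    have f: "f (pCons c p) s = c + \<i> * complex_of_real s * f p s"
      "f (pderiv (pCons c p)) s = f p s + \<i> * complex_of_real s * f (pderiv p) s" for s
      by (simp_all add: f_def pderiv_pCons)
    show ?case
      unfolding f
      using DERIV_add[OF DERIV_const[of "Im c"] DERIV_mult[OF DERIV_ident IH(2)]]
        DERIV_diff[OF DERIV_const[of "Re c"] DERIV_mult[OF DERIV_ident IH(1)]]
      by (simp add: algebra_simps)
  qed (simp add: f_def)
  then show "((\<lambda>s. Im (poly p (\<i> * complex_of_real s))) has_real_derivative
      Re (poly (pderiv p) (\<i> * complex_of_real s))) (at s)"
    and "((\<lambda>s. Re (poly p (\<i> * complex_of_real s))) has_real_derivative
      - Im (poly (pderiv p) (\<i> * complex_of_real s))) (at s)" by (simp_all add: f_def)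
qed

text \<open>At \<open>w = i * s0\<close> the value of \<open>p\<close> is real, and the real part of
  its logarithmic derivative is minus the phase rate \<open>S\<close>. The bound on
  \<open>a * S\<close> thus becomes one on the derivative of \<open>p\<close>, free of the
  roots.\<close>

lemma root_distance_imaginary_axis:
  fixes p :: "complex poly" and a s0 :: real
  assumes a: "0 < a" and roots: "\<And>z. poly p z = 0 \<Longrightarrow> a \<le> Re z"
    and im0: "Im (poly p (\<i> * complex_of_real s0)) = 0"
    and im: "\<And>s. s0 < s \<Longrightarrow> Im (poly p (\<i> * complex_of_real s)) \<noteq> 0"
  shows "a * \<bar>Re (poly (pderiv p) (\<i> * complex_of_real s0))\<bar>
    \<le> 3 * pi * \<bar>Re (poly p (\<i> * complex_of_real s0))\<bar>"
proof -
  define c where "c = coeff p (degree p)"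
  obtain zs where zs: "Polynomial.smult c (\<Prod>z\<leftarrow>zs. [:- z, 1:]) = p"
    using fundamental_theorem_algebra_factorized[of p] by (auto simp: c_def)
  have "p \<noteq> 0" using im[of "s0 + 1"] by auto
  then have c: "c \<noteq> 0" by (simp add: c_def)
  have poly_p: "poly p w = c * (\<Prod>z\<leftarrow>zs. w - z)" for w
  proof -
    have "poly (\<Prod>z\<leftarrow>zs. [:- z, 1:]) w = (\<Prod>z\<leftarrow>zs. w - z)" by (induction zs) (auto simp: algebra_simps)
    then show ?thesis by (simp flip: zs)
  qed
  have zs_Re: "a \<le> Re z" if "z \<in> set zs" for z
  proof (rule roots)
    show "poly p z = 0" unfolding poly_p using that by (auto simp: prod_list_zero_iff)
  qed
  define w where "w = \<i> * complex_of_real s0"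
  define S where "S = (\<Sum>z\<leftarrow>zs. Re z / (cmod (w - z))\<^sup>2)"
  have "a * S \<le> 3 * pi"
    unfolding S_def w_def using a zs_Re c im0 im
    by (intro phase_bound[of a zs c]) (auto simp: poly_p)
  have "w \<noteq> z" if "z \<in> set zs" for z using zs_Re[OF that] a by (auto simp: w_def)
  then have "poly (pderiv p) w = poly p w * (\<Sum>z\<leftarrow>zs. 1 / (w - z))"
    using poly_pderiv_prod_roots[of zs w] by (simp add: pderiv_smult flip: zs)
  then have "Re (poly (pderiv p) w) = Re (poly p w) * Re (\<Sum>z\<leftarrow>zs. 1 / (w - z))"
    using im0 by (simp add: w_def)
  also have "Re (\<Sum>z\<leftarrow>zs. 1 / (w - z)) = - S"
    unfolding S_def by (induction zs) (auto simp: Re_divide w_def cmod_power2)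
  finally have "a * \<bar>Re (poly (pderiv p) w)\<bar> = \<bar>a * S\<bar> * \<bar>Re (poly p w)\<bar>"
    using a by (simp add: abs_mult)
  moreover have "0 \<le> S"
    unfolding S_def using zs_Re a by (intro sum_list_nonneg) force
  moreover have "a * S * \<bar>Re (poly p w)\<bar> \<le> 3 * pi * \<bar>Re (poly p w)\<bar>"
    using \<open>a * S \<le> 3 * pi\<close> by (intro mult_right_mono) auto
  ultimately show ?thesis using a unfolding w_def[symmetric] by (simp add: abs_mult)
qed

section \<open>Upper bound\<close>

text \<open>Shooting from the left end: \<open>cheb x (n + 1) - (1 + \<alpha>) * cheb x n\<close> solves the eigenvalue equation
  at every site but the last, where it does so iff the shooting polynomial vanishes.\<close>

definition shooting :: "'a::comm_ring_1 \<Rightarrow> 'a \<Rightarrow> 'a \<Rightarrow> nat \<Rightarrow> 'a" where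
  "shooting x \<alpha> \<beta> N = (x - 2) * cheb x N - (\<alpha> + \<beta>) * (cheb x N - cheb x (N - 1))
     + \<alpha> * \<beta> * cheb x (N - 1)"

lemma poly_shooting: "poly (shooting p q r N) x = shooting (poly p x) (poly q x) (poly r x) N"
  by (simp add: shooting_def poly_cheb)

lemma shooting_root_eigenvector:
  fixes \<xi> \<eta> m :: real and g :: "nat \<Rightarrow> real" and z :: complex
  assumes N: "2 \<le> N" and \<xi>: "\<xi> \<noteq> 0" and inner: "\<And>i. 0 < i \<Longrightarrow> i < N - 1 \<Longrightarrow> g i = 0"
    and root: "shooting (2 + \<eta> / \<xi> + m / \<xi> * z\<^sup>2) (m * g 0 / \<xi> * z) (m * g (N - 1) / \<xi> * z) N = 0"
  shows "\<exists>p. chain_mode N \<xi> \<eta> m g z p"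
proof -
  define x \<alpha> \<beta> where "x = 2 + \<eta> / \<xi> + m / \<xi> * z\<^sup>2"
    and "\<alpha> = m * g 0 / \<xi> * z" and "\<beta> = m * g (N - 1) / \<xi> * z"
  have \<xi>x: "\<xi> * x = 2 * \<xi> + \<eta> + m * z\<^sup>2" using \<xi> by (simp add: x_def field_simps)
  have \<xi>\<alpha>: "\<xi> * \<alpha> = m * g 0 * z" and \<xi>\<beta>: "\<xi> * \<beta> = m * g (N - 1) * z"
    using \<xi> by (simp_all add: \<alpha>_def \<beta>_def)
  define f where "f n = cheb x (Suc n) - (1 + \<alpha>) * cheb x n" for n
  have f0: "f 0 = 1" and f1: "f 1 = (x - 1 - \<alpha>) * f 0" by (simp_all add: f_def)
  have rec: "f (n + 2) = x * f (n + 1) - f n" for n by (simp add: f_def algebra_simps)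
  obtain k where k: "N = Suc (Suc k)" using N by (metis add_2_eq_Suc le_Suc_ex)
  \<comment> \<open>By the recurrence the left side is \<open>f N\<close>, the value one site beyond
    the chain. The root condition is therefore the boundary condition at the right end.\<close>
  have last: "x * f (N - 1) - f (N - 2) = (1 + \<beta>) * f (N - 1)"
    using root unfolding x_def[symmetric] \<alpha>_def[symmetric] \<beta>_def[symmetric]
    by (simp add: shooting_def f_def k algebra_simps)
  define p where "p = vec N f"
  have p: "p \<in> carrier_vec N" by (simp add: p_def)
  have "p $ 0 = 1" using N by (simp add: p_def f0)
  then have p0: "p \<noteq> 0\<^sub>v N" using N by auto
  have "(tridiag_potential N \<xi> \<eta> *\<^sub>v p) $ i = z * m * (g i - z) * p $ i" if i: "i < N" for i
  proof -
    consider "i = 0" | "i = N - 1" | j where "i = Suc j" "0 < i" "i < N - 1"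
      using i by (cases i) fastforce+
    then show ?thesis
    proof cases
      case 1
      have "(tridiag_potential N \<xi> \<eta> *\<^sub>v p) $ i = \<eta> * f 0 + \<xi> * f 0 - \<xi> * f 1"
        using N 1 tridiag_mult_vec[OF p i] by (simp add: p_def algebra_simps)
      also have "\<xi> * f 1 = (\<xi> * x - \<xi> - \<xi> * \<alpha>) * f 0" unfolding f1 by (simp add: algebra_simps)
      finally show ?thesis using 1 N unfolding \<xi>x \<xi>\<alpha> p_def
        by (simp add: power2_eq_square algebra_simps)
    next
      case 2
      have i': "N - 1 - 1 = N - 2" by simp
      have "(tridiag_potential N \<xi> \<eta> *\<^sub>v p) $ i = \<eta> * f (N - 1) + \<xi> * f (N - 1) - \<xi> * f (N - 2)"
        using N 2 tridiag_mult_vec[OF p i] by (simp add: p_def i' algebra_simps numeral_2_eq_2)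
      also have "\<xi> * f (N - 2) = (\<xi> * x - \<xi> - \<xi> * \<beta>) * f (N - 1)"
      proof -
        have eq: "f (N - 2) = x * f (N - 1) - (1 + \<beta>) * f (N - 1)"
          using last by (simp add: algebra_simps)
        show ?thesis unfolding eq by (simp add: algebra_simps)
      qed
      finally show ?thesis using 2 N unfolding \<xi>x \<xi>\<beta> p_def
        by (simp add: power2_eq_square algebra_simps)
    next
      case 3
      have "(tridiag_potential N \<xi> \<eta> *\<^sub>v p) $ i
          = \<eta> * f (j + 1) + 2 * \<xi> * f (j + 1) - \<xi> * f j - \<xi> * f (j + 2)"
      proof -
        have "Suc (Suc j) < N" using 3 by simp
        then show ?thesis
          using 3 tridiag_mult_vec[OF p i, of \<xi> \<eta>] by (simp add: p_def algebra_simps)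
      qed
      also have "\<xi> * f (j + 2) = \<xi> * x * f (j + 1) - \<xi> * f j" unfolding rec by (simp add: algebra_simps)
      finally show ?thesis using 3 inner[of i] i unfolding \<xi>x p_def
        by (simp add: power2_eq_square algebra_simps)
    qed
  qed
  then show ?thesis using p p0 unfolding chain_mode_def by blast
qed

text \<open>The imaginary part is a multiple of \<open>end_minor\<close> for two damped ends as well as for one, since the
  two terminal minors coincide; hence \<open>I = {1, N}\<close> needs no separate treatment.\<close>

lemma shooting_imaginary_axis:
  "shooting (complex_of_real x) (\<i> * complex_of_real A) (\<i> * complex_of_real B) N
    = Complex ((x - 2) * cheb x N - A * B * cheb x (N - 1)) (- (A + B) * end_minor N x)"
  unfolding shooting_def end_minor_def of_real_cheb[symmetric]
  by (simp add: complex_eq_iff algebra_simps)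

text \<open>Roots of the shooting polynomial are eigenvalues, so their real parts are at least
  \<open>a\<close>. At the top zero of its imaginary part on the axis the derivative is at least of
  order \<open>N^3\<close> while the real part stays bounded.\<close>

lemma eigenvalue_Re_upper_bound:
  fixes \<xi> \<eta> m a :: real and g :: "nat \<Rightarrow> real"
  assumes \<xi>: "0 < \<xi>" and \<eta>: "0 < \<eta>" and m: "0 < m" and \<gamma>\<^sub>0: "0 < \<gamma>\<^sub>0"
    and N: "2 \<le> N" and damped: "end_damped N \<gamma>\<^sub>0 \<gamma>\<^sub>1 g"
    and a: "0 < a" and gap: "\<And>z p. chain_mode N \<xi> \<eta> m g z p \<Longrightarrow> a \<le> Re z"
  shows "a \<le> 12 * pi ^ 3 * \<xi>\<^sup>2 * (4 + (\<eta> + 4 * \<xi>) * m * \<gamma>\<^sub>1\<^sup>2 / \<xi>\<^sup>2) / (m * \<gamma>\<^sub>0 * \<eta>) / real N ^ 3"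
proof -
  have g: "\<And>i. i < N \<Longrightarrow> 0 \<le> g i \<and> g i \<le> \<gamma>\<^sub>1" and inner: "\<And>i. 0 < i \<Longrightarrow> i < N - 1 \<Longrightarrow> g i = 0"
    and ends: "\<gamma>\<^sub>0 \<le> g 0 \<or> \<gamma>\<^sub>0 \<le> g (N - 1)"
    using damped by (auto simp: end_damped_def)
  define X :: "complex poly" where "X = [:of_real (2 + \<eta> / \<xi>), 0, of_real (m / \<xi>):]"
  define p where "p = shooting X [:0, of_real (m * g 0 / \<xi>):] [:0, of_real (m * g (N - 1) / \<xi>):] N"
  have poly_p: "poly p z = shooting (2 + \<eta> / \<xi> + m / \<xi> * z\<^sup>2) (m * g 0 / \<xi> * z) (m * g (N - 1) / \<xi> * z) N" for z :: complex
    unfolding p_def poly_shooting by (simp add: X_def power2_eq_square algebra_simps)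
  have roots: "a \<le> Re z" if "poly p z = 0" for z
    using shooting_root_eigenvector[of N \<xi> g \<eta> m z] that N \<xi> inner gap unfolding poly_p by blast
  define k where "k = m * (g 0 + g (N - 1)) / \<xi>"
  have k: "m * \<gamma>\<^sub>0 / \<xi> \<le> k"
    unfolding k_def using ends g[of 0] g[of "N - 1"] N m \<xi>
    by (intro divide_right_mono mult_left_mono) auto
  have k0: "0 < k" using k m \<gamma>\<^sub>0 \<xi> by (smt (verit) divide_pos_pos mult_pos_pos)
  \<comment> \<open>\<open>x s\<close> is the recurrence coefficient at \<open>z = i * s\<close>. It
    decreases for \<open>s > 0\<close>, so the largest zero \<open>s0\<close> comes from the lowest
    zero \<open>x0\<close> of \<open>end_minor\<close>, through \<open>x s0 = x0\<close>.\<close>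
  define x where "x s = 2 + (\<eta> - m * s\<^sup>2) / \<xi>" for s
  have p_axis: "poly p (\<i> * complex_of_real s)
    = Complex ((x s - 2) * cheb (x s) N
          - (m * g 0 / \<xi> * s) * (m * g (N - 1) / \<xi> * s) * cheb (x s) (N - 1))
        (- k * s * end_minor N (x s))" for s
  proof -
    have "2 + \<eta> / \<xi> + m / \<xi> * (\<i> * complex_of_real s)\<^sup>2 = complex_of_real (x s)"
      by (simp add: x_def power_mult_distrib diff_divide_distrib)
    moreover have "h / \<xi> * (\<i> * complex_of_real s) = \<i> * complex_of_real (h / \<xi> * s)" for h :: real
      by simp
    moreover have "m * g 0 / \<xi> * s + m * g (N - 1) / \<xi> * s = k * s"
      by (simp add: k_def add_divide_distrib distrib_left distrib_right)
    ultimately show ?thesis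
      unfolding poly_p by (simp only: shooting_imaginary_axis mult_minus_left)
  qed
  define x0 where "x0 = - 2 * cos (2 * pi / (2 * real N - 1))"
  define D where "D = poly (pderiv (cheb [:0, 1:] N - cheb [:0, 1:] (N - 1))) x0"
  note top = end_minor_top_zero[OF N, folded x0_def, folded D_def]
  have x0: "- 2 \<le> x0" "x0 \<le> 2"
    using cos_ge_minus_one[of "2 * pi / (2 * real N - 1)"] cos_le_one[of "2 * pi / (2 * real N - 1)"]
    unfolding x0_def by linarith+
  define s0 where "s0 = sqrt ((\<eta> + \<xi> * (2 - x0)) / m)"
  have num0: "0 \<le> \<xi> * (2 - x0)" "\<xi> * (2 - x0) \<le> 4 * \<xi>" using \<xi> x0 by auto
  have ms0: "m * s0\<^sup>2 = \<eta> + \<xi> * (2 - x0)"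
    unfolding s0_def using num0 \<eta> m by (subst real_sqrt_pow2) auto
  have s0: "0 < s0" unfolding s0_def using num0 \<eta> m by simp
  have xs0: "x s0 = x0" using \<xi> by (simp add: x_def ms0)
  have im0: "Im (poly p (\<i> * complex_of_real s0)) = 0"
    unfolding p_axis xs0 using top(1) by simp
  have im: "Im (poly p (\<i> * complex_of_real s)) \<noteq> 0" if s: "s0 < s" for s
  proof -
    have "s0\<^sup>2 < s\<^sup>2" using s s0 by (intro power_strict_mono) auto
    then have "x s < x0" unfolding xs0[symmetric] x_def using m \<xi> by (simp add: divide_strict_right_mono)
    then show ?thesis
      using end_minor_nonzero[OF N, of "x s"] k0 s s0 by (simp add: p_axis x0_def)
  qed
  \<comment> \<open>The product-rule term that differentiates the factor \<open>s\<close> drops out,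
    because \<open>end_minor\<close> vanishes at \<open>x0\<close>.\<close>
  have deriv: "Re (poly (pderiv p) (\<i> * complex_of_real s0)) = 2 * k / \<xi> * (m * s0\<^sup>2) * D"
  proof -
    have dx: "(x has_real_derivative - 2 * m * s0 / \<xi>) (at s0)"
      unfolding x_def using \<xi> by (auto intro!: derivative_eq_intros)
    have "(end_minor N has_real_derivative D) (at (x s0))"
      unfolding xs0 D_def by (rule end_minor_DERIV)
    from DERIV_chain2[OF this dx]
    have "((\<lambda>s. end_minor N (x s)) has_real_derivative D * (- 2 * m * s0 / \<xi>)) (at s0)" .
    from DERIV_mult[OF DERIV_cmult_Id[of "- k"] this]
    have "((\<lambda>s. - k * s * end_minor N (x s)) has_real_derivative
        2 * k / \<xi> * (m * s0\<^sup>2) * D) (at s0)"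
      by (simp add: xs0 top(1) power2_eq_square mult_ac)
    moreover have "((\<lambda>s. - k * s * end_minor N (x s)) has_real_derivative
        Re (poly (pderiv p) (\<i> * complex_of_real s0))) (at s0)"
      using DERIV_poly_imaginary_axis(1)[of p s0] by (simp add: p_axis)
    ultimately show ?thesis by (rule DERIV_unique[symmetric])
  qed
  have eq: "cheb x0 (N - 1) = cheb x0 N" using top(1) by (simp add: end_minor_def)
  \<comment> \<open>The two \<open>cheb\<close> values agree at \<open>x0\<close>, so the real part
    is \<open>x0 - 2 - T\<close> times \<open>cheb x0 N\<close>. The \<open>4\<close> bounds
    \<open>|x0 - 2|\<close>; the rest bounds \<open>T\<close>, which stems from the product of the
    two end frictions.\<close>
  define R where "R = 4 + (\<eta> + 4 * \<xi>) * m * \<gamma>\<^sub>1\<^sup>2 / \<xi>\<^sup>2"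
  have re: "\<bar>Re (poly p (\<i> * complex_of_real s0))\<bar> \<le> R"
  proof -
    define T where "T = (m * s0\<^sup>2) * m * (g 0 * g (N - 1)) / \<xi>\<^sup>2"
    have "Re (poly p (\<i> * complex_of_real s0)) = (x0 - 2 - T) * cheb x0 N"
      unfolding p_axis xs0 eq T_def by (simp add: power2_eq_square algebra_simps)
    then have "\<bar>Re (poly p (\<i> * complex_of_real s0))\<bar> = \<bar>x0 - 2 - T\<bar> * \<bar>cheb x0 N\<bar>"
      by (simp only: abs_mult)
    also have "\<dots> \<le> \<bar>x0 - 2 - T\<bar> * 1" using top(2) by (intro mult_left_mono) auto
    finally have "\<bar>Re (poly p (\<i> * complex_of_real s0))\<bar> \<le> \<bar>x0 - 2 - T\<bar>" by simp
    moreover have "T \<le> R - 4"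
    proof -
      have "T \<le> (\<eta> + 4 * \<xi>) * m * \<gamma>\<^sub>1\<^sup>2 / \<xi>\<^sup>2"
        unfolding T_def power2_eq_square[of \<gamma>\<^sub>1] ms0 using num0 \<eta> m \<xi> g[of 0] g[of "N - 1"] N
        by (intro divide_right_mono mult_mono) auto
      then show ?thesis by (simp add: R_def)
    qed
    moreover have "0 \<le> T" unfolding T_def using m g[of 0] g[of "N - 1"] N by simp
    ultimately show ?thesis using x0 by linarith
  qed
  have "a * (2 * (m * \<gamma>\<^sub>0 / \<xi>) / \<xi> * \<eta> * (real N ^ 3 / (8 * pi\<^sup>2)))
      \<le> a * \<bar>2 * k / \<xi> * (m * s0\<^sup>2) * D\<bar>"
  proof -
    have "2 * (m * \<gamma>\<^sub>0 / \<xi>) / \<xi> * \<eta> * (real N ^ 3 / (8 * pi\<^sup>2)) \<le> 2 * k / \<xi> * (m * s0\<^sup>2) * \<bar>D\<bar>"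
      using k k0 \<xi> \<eta> m \<gamma>\<^sub>0 num0 top(3) unfolding ms0
      by (intro mult_mono divide_right_mono) auto
    also have "\<dots> = \<bar>2 * k / \<xi> * (m * s0\<^sup>2) * D\<bar>"
      using k0 \<xi> m by (simp add: abs_mult)
    finally show ?thesis using a by (intro mult_left_mono) auto
  qed
  also have "\<dots> \<le> 3 * pi * \<bar>Re (poly p (\<i> * complex_of_real s0))\<bar>"
    using root_distance_imaginary_axis[OF a roots im0 im] unfolding deriv .
  also have "\<dots> \<le> 3 * pi * R" using re by (intro mult_left_mono) auto
  finally have "a * (2 * (m * \<gamma>\<^sub>0 / \<xi>) / \<xi> * \<eta> * (real N ^ 3 / (8 * pi\<^sup>2))) \<le> 3 * pi * R" .
  then show ?thesis
    unfolding R_def[symmetric] using \<xi> \<eta> m \<gamma>\<^sub>0 N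
    by (simp add: field_simps power2_eq_square power3_eq_cube)
qed

section \<open>From bounds on single eigenvalues to the spectral gap\<close>

lemma spectrum_gap_props:
  assumes "A \<in> carrier_mat n n" "0 < n"
  shows "\<exists>z \<in> spectrum A. spectral_gap A = Re z" and "z \<in> spectrum A \<Longrightarrow> spectral_gap A \<le> Re z"
proof -
  have fin: "finite (Re ` spectrum A)" and ne: "Re ` spectrum A \<noteq> {}"
    using card_finite_spectrum(1)[OF assms(1)] spectrum_non_empty[OF assms] by auto
  have gap: "spectral_gap A = Min (Re ` spectrum A)"
    unfolding spectral_gap_def using fin ne by (rule cInf_eq_Min)
  show "\<exists>z \<in> spectrum A. spectral_gap A = Re z" using Min_in[OF fin ne] gap by auto
  show "z \<in> spectrum A \<Longrightarrow> spectral_gap A \<le> Re z" unfolding gap using fin by (intro Min_le) auto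
qed

theorem proposition3p2:
  fixes \<xi> \<eta> m \<gamma>\<^sub>l \<gamma>\<^sub>r :: real
  assumes "\<xi> > 0" and "\<eta> > 0" and "m > 0" and "\<gamma>\<^sub>l > 0" and "\<gamma>\<^sub>r > 0"
  shows "\<exists>c > 0. \<exists>C > 0. \<forall>N \<ge> 1. \<forall>I. I \<noteq> {} \<and> I \<subseteq> {1, N} \<longrightarrow>
           (let gap = spectral_gap (chain_mat N \<xi> \<eta> m I (\<lambda>n. if n = 1 then \<gamma>\<^sub>l else \<gamma>\<^sub>r))
            in c * real N powi (- 3) \<le> gap \<and> gap \<le> C * real N powi (- 3))"
proof -
  \<comment> \<open>One pair of bounds then serves every admissible \<open>I\<close> and every
    \<open>N\<close>.\<close>
  define \<gamma>\<^sub>0 \<gamma>\<^sub>1 where "\<gamma>\<^sub>0 = min \<gamma>\<^sub>l \<gamma>\<^sub>r" and "\<gamma>\<^sub>1 = max \<gamma>\<^sub>l \<gamma>\<^sub>r"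
  have \<gamma>: "0 < \<gamma>\<^sub>0" "0 < \<gamma>\<^sub>1" using assms by (auto simp: \<gamma>\<^sub>0_def \<gamma>\<^sub>1_def)
  define M where "M N I = chain_mat N \<xi> \<eta> m I (\<lambda>n. if n = 1 then \<gamma>\<^sub>l else \<gamma>\<^sub>r)" for N I
  define g where "g I i = (if Suc i \<in> I then if Suc i = 1 then \<gamma>\<^sub>l else \<gamma>\<^sub>r else 0)" for I i
  have M: "M N I \<in> carrier_mat (N + N) (N + N)" for N I
    unfolding M_def chain_mat_def chain_potential_eq
    by (rule four_block_carrier_mat) (auto simp: friction_mat_def tridiag_potential_def)
  have spec: "z \<in> spectrum (M N I) \<longleftrightarrow> (\<exists>p. chain_mode N \<xi> \<eta> m (g I) z p)" for z N I
    unfolding M_def g_def using assms by (intro spectrum_chain_mat_iff) auto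
  have damped: "end_damped N \<gamma>\<^sub>0 \<gamma>\<^sub>1 (g I)" if "I \<noteq> {}" "I \<subseteq> {1, N}" "1 \<le> N" for N I
  proof -
    have "1 \<in> I \<or> N \<in> I" using that(1,2) by auto
    then have "\<gamma>\<^sub>0 \<le> g I 0 \<or> \<gamma>\<^sub>0 \<le> g I (N - 1)" using that(3) by (auto simp: g_def \<gamma>\<^sub>0_def)
    moreover have "0 \<le> g I i \<and> g I i \<le> \<gamma>\<^sub>1" for i using assms by (auto simp: g_def \<gamma>\<^sub>1_def)
    moreover have "g I i = 0" if "0 < i" "i < N - 1" for i
      using that \<open>I \<subseteq> {1, N}\<close> by (auto simp: g_def)
    ultimately show ?thesis unfolding end_damped_def by blast
  qed
  obtain c where c: "0 < c" and lower: "\<forall>N g z p. 1 \<le> N \<and> end_damped N \<gamma>\<^sub>0 \<gamma>\<^sub>1 g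
      \<and> chain_mode N \<xi> \<eta> m g z p \<longrightarrow> c / real N ^ 3 \<le> Re z"
    using eigenvalue_Re_lower_bound[OF assms(1-3) \<gamma>] by blast
  \<comment> \<open>The first entry covers \<open>N = 1\<close>, where \<open>I = {1}\<close> is the
    only choice; the second is the bound for \<open>N \<ge> 2\<close>.\<close>
  define C where "C = max (spectral_gap (M 1 {1}))
    (12 * pi ^ 3 * \<xi>\<^sup>2 * (4 + (\<eta> + 4 * \<xi>) * m * \<gamma>\<^sub>1\<^sup>2 / \<xi>\<^sup>2) / (m * \<gamma>\<^sub>0 * \<eta>))"
  have main: "c / real N ^ 3 \<le> spectral_gap (M N I) \<and> spectral_gap (M N I) \<le> C / real N ^ 3"
    if N: "1 \<le> N" and I: "I \<noteq> {}" "I \<subseteq> {1, N}" for N I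
  proof
    note gap = spectrum_gap_props[OF M[of N I]]
    obtain z where z: "z \<in> spectrum (M N I)" "spectral_gap (M N I) = Re z" using gap(1) N by auto
    then show low: "c / real N ^ 3 \<le> spectral_gap (M N I)"
      using lower N damped[OF I N] unfolding spec by auto
    show "spectral_gap (M N I) \<le> C / real N ^ 3"
    proof (cases "N = 1")
      case True
      then have "I = {1}" using I by auto
      then show ?thesis using True by (simp add: C_def)
    next
      case False
      then have N2: "2 \<le> N" using N by simp
      \<comment> \<open>The upper bound is applied with \<open>a\<close> the gap itself, whose
        positivity comes from the lower bound.\<close>
      have "0 < c / real N ^ 3" using c N by simp
      then have pos: "0 < spectral_gap (M N I)" using low by linarith
      have "spectral_gap (M N I) \<le> Re z" if "chain_mode N \<xi> \<eta> m (g I) z p" for z p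
        using gap(2)[of z] that N unfolding spec by auto
      then have "spectral_gap (M N I) \<le> 12 * pi ^ 3 * \<xi>\<^sup>2 * (4 + (\<eta> + 4 * \<xi>) * m * \<gamma>\<^sub>1\<^sup>2 / \<xi>\<^sup>2)
          / (m * \<gamma>\<^sub>0 * \<eta>) / real N ^ 3"
        by (rule eigenvalue_Re_upper_bound[OF assms(1-3) \<gamma>(1) N2 damped[OF I N] pos])
      also have "\<dots> \<le> C / real N ^ 3" unfolding C_def by (intro divide_right_mono) auto
      finally show ?thesis .
    qed
  qed
  have "0 < 12 * pi ^ 3 * \<xi>\<^sup>2 * (4 + (\<eta> + 4 * \<xi>) * m * \<gamma>\<^sub>1\<^sup>2 / \<xi>\<^sup>2) / (m * \<gamma>\<^sub>0 * \<eta>)"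
    using assms \<gamma> by (intro divide_pos_pos mult_pos_pos) (auto intro!: add_pos_nonneg)
  then have "0 < C" by (simp add: C_def)
  moreover have "x * real N powi (- 3) = x / real N ^ 3" for x N
    by (simp add: power_int_minus divide_inverse)
  ultimately show ?thesis
    using c main unfolding M_def Let_def by (intro exI[of _ c] exI[of _ C] conjI) auto
qed

end
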